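(* Let $(X^\sim,\mathcal E)$ be the quotient space of the augmented tree of an IFS $\{S_i\}_{i=1}^N$ of contractive similitudes on $\mathbb R^d$, and let $(X^\sim,\mathcal E_v^* )$ be its reduced tree. Suppose $(X^\sim,\mathcal E)$ is simple, and suppose its incidence matrix $A$ is $(B,\mathbf u)$-rearrangeable, where $B$ is the incidence matrix of the reduced tree $(X^\sim,\mathcal E_v^* )$ and $\mathbf u$ is the representation of the equivalence classes of horizontal components of $X^\sim$ by the equivalence classes of vertices of $(X^\sim,\mathcal E_v^* )$. Then there exists a near-isometry between the quotient space $(X^\sim,\mathcal E)$ and the reduced tree $(X^\sim,\mathcal E_v^* )$, and consequently $\partial(X^\sim,\mathcal E)\simeq\partial(X^\sim,\mathcal E_v^* )$.
   Context: **Augmented tree.** Let $\{S_i\}_{i=1}^N$ be an IFS of contractive similitudes on $\mathbb R^d$, $S_i$ having contraction ratio $r_i\in(0,1)$, and let $K$ be its self-similar set, i.e. the unique non-empty compact set with $K=\bigcup_{i=1}^N S_i(K)$. Let $\Sigma=\{1,\dots,N\}$ and let $\Sigma^*$ be the set of finite words over $\Sigma$, including the empty word $\vartheta$. For $x=i_1\cdots i_k\in\Sigma^*$ put $S_x=S_{i_1}\circ\cdots\circ S_{i_k}$ and $r_x=r_{i_1}\cdots r_{i_k}$. Let $r=\min_i r_i$, $X_0=\{\vartheta\}$, $X_n=\{x=i_1\cdots i_k\in\Sigma^*: r_x\le r^n<r_{i_1}\cdots r_{i_{k-1}}\}$ for $n\ge1$, and $X=\bigcup_{n\ge0}X_n$.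 If $x\in X_n$ write $|x|=n$. For each $y\in X_n$, $n\ge1$, there is a unique prefix $x\in X_{n-1}$ of $y$, its parent; $\mathcal E_v$ is the (symmetric) set of edges joining a vertex to its parent. Fix $\kappa>0$ and let $\mathcal E_h=\{(x,y): |x|=|y|,\ x\ne y,\ \mathrm{dist}(S_x(K),S_y(K))\le\kappa r^{|x|}\}$, $\mathcal E=\mathcal E_v\cup\mathcal E_h$. The graph $(X,\mathcal E)$ with root $\vartheta$ is the augmented tree. **Quotient space and reduced tree.** $X^\sim$ is the quotient of $X$ by the relation identifying $x,y$ when $|x|=|y|$ and $S_x=S_y$. It carries the induced edges, still denoted $\mathcal E_v,\mathcal E_h,\mathcal E=\mathcal E_v\cup\mathcal E_h$: two distinct classes are joined by a vertical (resp. horizontal) edge if some representatives are. A vertex of $X^\sim$ may have several parents. The reduced tree $(X^\sim,\mathcal E_v^* )$ is obtained by keeping, for each non-root vertex $y\in X^\sim$ with parents $x_1<x_2<\dots<x_k$ in lexicographical order of finite words (comparing, say, the smallest representing words), only the vertical edge $(x_1,y)$ and removing all other vertical edges from $y$ to its parents. **Simple; incidence matrices.** A horizontal component of $X^\sim$ is a maximal subset $T$ of some level that is connected with respect to $\mathcal E_h$; $\mathcal F$ is the set of all of them. $T_{\mathcal D}$ is the union of $T$ and all its descendants, with the edges of $\mathcal E$ restricted to it. $T\sim T'$ if there is a graph isomorphism $T_{\mathcal D}\to T'_{\mathcal D}$ that, together with its inverse, preserves vertical edges (as parent–child relations) and horizontal edges. $(X^\sim,\mathcal E)$ is simple if $\mathcal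 F/\!\sim$ is finite; then, with classes $[T_1],\dots,[T_m]$, its incidence matrix is $A=[a_{ij}]_{m\times m}$, $a_{ij}$ being the number of horizontal components consisting of offspring of $T\in[T_i]$ that belong to $[T_j]$. Vertices $x,y$ of the reduced tree are equivalent if the subtrees of $(X^\sim,\mathcal E_v^* )$ formed by $x$ and its descendants and by $y$ and its descendants are isomorphic (preserving the parent–child relation); the tree is simple if there are finitely many classes $[\mathbf t_1],\dots,[\mathbf t_n]$, ordered with $\vartheta\in[\mathbf t_1]$, and its incidence matrix is $B=[b_{ij}]_{n\times n}$, $b_{ij}$ being the number of offspring (in $(X^\sim,\mathcal E_v^* )$) of a vertex in $[\mathbf t_i]$ that belong to $[\mathbf t_j]$. For $T\in[T_i]$ let $u_{ij}$ be the number of vertices of $T$ in $[\mathbf t_j]$, $\mathbf u_i=[u_{i1},\dots,u_{in}]$, $\mathbf u=[\mathbf u_1,\dots,\mathbf u_m]$. (The use of $B$ and $\mathbf u$ presupposes that the reduced tree is simple and that $\mathbf u_i$ depends only on the class $[T_i]$.) **Rearrangeable.** Let $B$ be an $n\times n$ nonnegative integer matrix with rows $\mathbf b_1,\dots,\mathbf b_n$, and $\mathbf u=[\mathbf u_1,\dots,\mathbf u_m]$ with $\mathbf u_i=[u_{i1},\dots,u_{in}]$ a vector of nonnegative integers. An $m\times m$ matrix $A$ with rows $\mathbf a_1,\dots,\mathbf a_m$ is $(B,\mathbf u)$-rearrangeable if for each $i$ there is a nonnegative integer matrix $C=[c_{sj}]_{p\times m}$, $p=\sum_{j=1}^n u_{ij}$,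 such that $\mathbf a_i=\mathbf 1C$ (i.e. $\mathbf a_i$ is the sum of the rows of $C$) and, putting $\mathbf c_s=\sum_{j=1}^m c_{sj}\mathbf u_j$ for $1\le s\le p$, the list $\mathbf c_1,\dots,\mathbf c_p$ consists of exactly $u_{ij}$ terms assigned the value $\mathbf b_j$ for each $j=1,\dots,n$ (condition: $\#\{\mathbf c_k:\mathbf c_k=\mathbf b_j,\ k=1,\dots,p\}=u_{ij}$). **Hyperbolicity, near-isometry.** For a connected graph with root $\vartheta$ and graph distance $d$, let $|x|=d(\vartheta,x)$ and $|x\wedge y|=\frac12(|x|+|y|-d(x,y))$. The graph is hyperbolic if there is $\delta\ge0$ with $|x\wedge y|\ge\min\{|x\wedge z|,|z\wedge y|\}-\delta$ for all $x,y,z$. It is known that $(X,\mathcal E)$ and $(X^\sim,\mathcal E)$ are hyperbolic; trees are hyperbolic with $\delta=0$. For $a>0$ let $\rho_a(x,x)=0$ and $\rho_a(x,y)=\exp(-a|x\wedge y|)$ for $x\ne y$; for $a$ small ($\exp(3\delta a)<\sqrt2$) $\rho_a$ is equivalent (up to multiplicative constants) to a metric, called a visual metric. The hyperbolic boundary $\partial$ of the graph is the $\rho_a$-completion minus the vertex set, equipped with the extension of $\rho_a$ (defined up to bi-Lipschitz equivalence). The same parameter $a$ is used for both graphs. A near-isometry between connected graphs is a bijection $\sigma$ of vertex sets for which there is $L>0$ with $|d(\sigma(x),\sigma(y))-d(x,y)|<L$ for all $x,y$. Metric spaces are Lipschitz equivalent, $\simeq$, if there is a bi-Lipschitz bijection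 between them. *)

theory Defs
  imports
    "HOL-Analysis.Analysis"
    "HOL-Library.Sublist"
    "HOL-Library.List_Lexorder"
begin

subsection \<open>Iterated function systems and words\<close>

text \<open>
  The maps are \<open>S 1, \<dots>, S N\<close> with contraction ratios \<open>c 1, \<dots>, c N\<close>; words over
  \<open>{1..N}\<close> are lists, and the empty word is \<open>[]\<close>.
\<close>

definition self_similar_ifs ::
    "nat \<Rightarrow> (nat \<Rightarrow> real) \<Rightarrow> (nat \<Rightarrow> real ^ 'd \<Rightarrow> real ^ 'd) \<Rightarrow> (real ^ 'd) set \<Rightarrow> bool" where
  "self_similar_ifs N c S K \<longleftrightarrow>
     1 \<le> N \<and>
     (\<forall>i\<in>{1..N}. 0 < c i \<and> c i < 1 \<and> (\<forall>x y. dist (S i x) (S i y) = c i * dist x y)) \<and>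
     compact K \<and> K \<noteq> {} \<and> K = (\<Union>i\<in>{1..N}. S i ` K)"

definition word_map :: "(nat \<Rightarrow> 'p \<Rightarrow> 'p) \<Rightarrow> nat list \<Rightarrow> 'p \<Rightarrow> 'p" where
  "word_map S w = foldr (\<lambda>i g. S i \<circ> g) w id"

definition word_ratio :: "(nat \<Rightarrow> real) \<Rightarrow> nat list \<Rightarrow> real" where
  "word_ratio c w = prod_list (map c w)"

definition min_ratio :: "nat \<Rightarrow> (nat \<Rightarrow> real) \<Rightarrow> real" where
  "min_ratio N c = Min (c ` {1..N})"

definition word_level :: "nat \<Rightarrow> (nat \<Rightarrow> real) \<Rightarrow> nat \<Rightarrow> nat list set" where
  "word_level N c n =
     (if n = 0 then {[]}
      else {w. w \<noteq> [] \<and> set w \<subseteq> {1..N} \<and>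
               word_ratio c w \<le> min_ratio N c ^ n \<and>
               min_ratio N c ^ n < word_ratio c (butlast w)})"


subsection \<open>The augmented tree\<close>

definition aug_verts :: "nat \<Rightarrow> (nat \<Rightarrow> real) \<Rightarrow> nat list set" where
  "aug_verts N c = (\<Union>n. word_level N c n)"

text \<open>
  Vertical edges are stored as directed pairs (parent, child); the undirected edge set
  \<open>\<E>\<^sub>v\<close> is the union of such a relation and its converse.
\<close>

definition aug_parent :: "nat \<Rightarrow> (nat \<Rightarrow> real) \<Rightarrow> (nat list \<times> nat list) set" where
  "aug_parent N c =
     {(x, y). \<exists>n. x \<in> word_level N c n \<and> y \<in> word_level N c (Suc n) \<and> prefix x y}"

definition aug_horiz ::
    "nat \<Rightarrow> (nat \<Rightarrow> real) \<Rightarrow> (nat \<Rightarrow> real ^ 'd \<Rightarrow> real ^ 'd) \<Rightarrow> (real ^ 'd) set \<Rightarrow> real \<Rightarrow>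
     (nat list \<times> nat list) set" where
  "aug_horiz N c S K \<kappa> =
     {(x, y). \<exists>n. x \<in> word_level N c n \<and> y \<in> word_level N c n \<and> x \<noteq> y \<and>
                  setdist (word_map S x ` K) (word_map S y ` K) \<le> \<kappa> * min_ratio N c ^ n}"


subsection \<open>The quotient space and the reduced tree\<close>

text \<open>Vertices of the quotient are equivalence classes, that is, sets of words.\<close>

definition same_map ::
    "nat \<Rightarrow> (nat \<Rightarrow> real) \<Rightarrow> (nat \<Rightarrow> 'p \<Rightarrow> 'p) \<Rightarrow> (nat list \<times> nat list) set" where
  "same_map N c S =
     {(x, y). (\<exists>n. x \<in> word_level N c n \<and> y \<in> word_level N c n) \<and> word_map S x = word_map S y}"

definition quot_verts ::
    "nat \<Rightarrow> (nat \<Rightarrow> real) \<Rightarrow> (nat \<Rightarrow> 'p \<Rightarrow> 'p) \<Rightarrow> nat list set set" where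
  "quot_verts N c S = aug_verts N c // same_map N c S"

definition quot_level ::
    "nat \<Rightarrow> (nat \<Rightarrow> real) \<Rightarrow> (nat \<Rightarrow> 'p \<Rightarrow> 'p) \<Rightarrow> nat \<Rightarrow> nat list set set" where
  "quot_level N c S n = word_level N c n // same_map N c S"

definition quot_root ::
    "nat \<Rightarrow> (nat \<Rightarrow> real) \<Rightarrow> (nat \<Rightarrow> 'p \<Rightarrow> 'p) \<Rightarrow> nat list set" where
  "quot_root N c S = same_map N c S `` {[]}"

definition induced_edges ::
    "nat list set set \<Rightarrow> (nat list \<times> nat list) set \<Rightarrow> (nat list set \<times> nat list set) set" where
  "induced_edges V R = {(p, q). p \<in> V \<and> q \<in> V \<and> p \<noteq> q \<and> (\<exists>x\<in>p. \<exists>y\<in>q. (x, y) \<in> R)}"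

definition quot_parent ::
    "nat \<Rightarrow> (nat \<Rightarrow> real) \<Rightarrow> (nat \<Rightarrow> 'p \<Rightarrow> 'p) \<Rightarrow> (nat list set \<times> nat list set) set" where
  "quot_parent N c S = induced_edges (quot_verts N c S) (aug_parent N c)"

definition quot_horiz ::
    "nat \<Rightarrow> (nat \<Rightarrow> real) \<Rightarrow> (nat \<Rightarrow> real ^ 'd \<Rightarrow> real ^ 'd) \<Rightarrow> (real ^ 'd) set \<Rightarrow> real \<Rightarrow>
     (nat list set \<times> nat list set) set" where
  "quot_horiz N c S K \<kappa> = induced_edges (quot_verts N c S) (aug_horiz N c S K \<kappa>)"

definition quot_edges ::
    "nat \<Rightarrow> (nat \<Rightarrow> real) \<Rightarrow> (nat \<Rightarrow> real ^ 'd \<Rightarrow> real ^ 'd) \<Rightarrow> (real ^ 'd) set \<Rightarrow> real \<Rightarrow>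
     (nat list set \<times> nat list set) set" where
  "quot_edges N c S K \<kappa> =
     quot_parent N c S \<union> (quot_parent N c S)\<inverse> \<union> quot_horiz N c S K \<kappa>"

text \<open>
  Parents are compared through their lexicographically smallest representing words; \<open>Min\<close>
  and \<open>\<le>\<close> refer to the lexicographic order on lists.
\<close>

definition red_parent ::
    "nat \<Rightarrow> (nat \<Rightarrow> real) \<Rightarrow> (nat \<Rightarrow> 'p \<Rightarrow> 'p) \<Rightarrow> (nat list set \<times> nat list set) set" where
  "red_parent N c S =
     {(p, q). (p, q) \<in> quot_parent N c S \<and>
              (\<forall>p'. (p', q) \<in> quot_parent N c S \<longrightarrow> Min p \<le> Min p')}"

definition red_edges ::
    "nat \<Rightarrow> (nat \<Rightarrow> real) \<Rightarrow> (nat \<Rightarrow> 'p \<Rightarrow> 'p) \<Rightarrow> (nat list set \<times> nat list set) set" where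
  "red_edges N c S = red_parent N c S \<union> (red_parent N c S)\<inverse>"


subsection \<open>Horizontal components, simplicity and incidence matrices\<close>

definition edge_connected :: "('v \<times> 'v) set \<Rightarrow> 'v set \<Rightarrow> bool" where
  "edge_connected H T \<longleftrightarrow> (\<forall>x\<in>T. \<forall>y\<in>T. (x, y) \<in> (H \<inter> T \<times> T)\<^sup>*)"

definition horiz_components ::
    "nat \<Rightarrow> (nat \<Rightarrow> real) \<Rightarrow> (nat \<Rightarrow> real ^ 'd \<Rightarrow> real ^ 'd) \<Rightarrow> (real ^ 'd) set \<Rightarrow> real \<Rightarrow>
     nat list set set set" where
  "horiz_components N c S K \<kappa> =
     {T. T \<noteq> {} \<and>
         (\<exists>n. T \<subseteq> quot_level N c S n \<and> edge_connected (quot_horiz N c S K \<kappa>) T \<and>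
              (\<forall>T'. T \<subseteq> T' \<and> T' \<subseteq> quot_level N c S n \<and>
                    edge_connected (quot_horiz N c S K \<kappa>) T' \<longrightarrow> T' = T))}"

text \<open>\<open>P\<close> is a relation of pairs (parent, child).\<close>

definition with_descendants :: "('v \<times> 'v) set \<Rightarrow> 'v set \<Rightarrow> 'v set" where
  "with_descendants P T = P\<^sup>* `` T"

definition iso_between :: "('v \<times> 'v) set \<Rightarrow> 'v set \<Rightarrow> 'v set \<Rightarrow> ('v \<Rightarrow> 'v) \<Rightarrow> bool" where
  "iso_between R D D' f \<longleftrightarrow>
     bij_betw f D D' \<and> (\<forall>x\<in>D. \<forall>y\<in>D. (x, y) \<in> R \<longleftrightarrow> (f x, f y) \<in> R)"

definition component_equiv ::
    "nat \<Rightarrow> (nat \<Rightarrow> real) \<Rightarrow> (nat \<Rightarrow> real ^ 'd \<Rightarrow> real ^ 'd) \<Rightarrow> (real ^ 'd) set \<Rightarrow> real \<Rightarrow>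
     (nat list set set \<times> nat list set set) set" where
  "component_equiv N c S K \<kappa> =
     {(T, T'). T \<in> horiz_components N c S K \<kappa> \<and> T' \<in> horiz_components N c S K \<kappa> \<and>
        (\<exists>f. iso_between (quot_parent N c S)
                (with_descendants (quot_parent N c S) T)
                (with_descendants (quot_parent N c S) T') f \<and>
             iso_between (quot_horiz N c S K \<kappa>)
                (with_descendants (quot_parent N c S) T)
                (with_descendants (quot_parent N c S) T') f)}"

definition component_classes ::
    "nat \<Rightarrow> (nat \<Rightarrow> real) \<Rightarrow> (nat \<Rightarrow> real ^ 'd \<Rightarrow> real ^ 'd) \<Rightarrow> (real ^ 'd) set \<Rightarrow> real \<Rightarrow>
     nat list set set set set" where
  "component_classes N c S K \<kappa> = horiz_components N c S K \<kappa> // component_equiv N c S K \<kappa>"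

definition quot_simple ::
    "nat \<Rightarrow> (nat \<Rightarrow> real) \<Rightarrow> (nat \<Rightarrow> real ^ 'd \<Rightarrow> real ^ 'd) \<Rightarrow> (real ^ 'd) set \<Rightarrow> real \<Rightarrow> bool" where
  "quot_simple N c S K \<kappa> \<longleftrightarrow> finite (component_classes N c S K \<kappa>)"

definition vertex_equiv ::
    "nat \<Rightarrow> (nat \<Rightarrow> real) \<Rightarrow> (nat \<Rightarrow> 'p \<Rightarrow> 'p) \<Rightarrow> (nat list set \<times> nat list set) set" where
  "vertex_equiv N c S =
     {(x, y). x \<in> quot_verts N c S \<and> y \<in> quot_verts N c S \<and>
        (\<exists>f. iso_between (red_parent N c S)
                (with_descendants (red_parent N c S) {x})
                (with_descendants (red_parent N c S) {y}) f)}"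

definition vertex_classes ::
    "nat \<Rightarrow> (nat \<Rightarrow> real) \<Rightarrow> (nat \<Rightarrow> 'p \<Rightarrow> 'p) \<Rightarrow> nat list set set set" where
  "vertex_classes N c S = quot_verts N c S // vertex_equiv N c S"

definition red_simple ::
    "nat \<Rightarrow> (nat \<Rightarrow> real) \<Rightarrow> (nat \<Rightarrow> 'p \<Rightarrow> 'p) \<Rightarrow> bool" where
  "red_simple N c S \<longleftrightarrow> finite (vertex_classes N c S)"

text \<open>
  A finite set of classes is enumerated without repetition by a function on \<open>{1..k}\<close>.
  An \<open>m \<times> n\<close> matrix is a function of two indices, of which only the values on
  \<open>{1..m} \<times> {1..n}\<close> matter. Each of the following predicates requires the counted number
  to be the same for every representative of the class.
\<close>

definition quot_incidence_matrix ::
    "nat \<Rightarrow> (nat \<Rightarrow> real) \<Rightarrow> (nat \<Rightarrow> 'p \<Rightarrow> 'p) \<Rightarrow> nat \<Rightarrow> (nat \<Rightarrow> nat list set set set) \<Rightarrow>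
     (nat \<Rightarrow> nat \<Rightarrow> nat) \<Rightarrow> bool" where
  "quot_incidence_matrix N c S m \<T> A \<longleftrightarrow>
     (\<forall>i\<in>{1..m}. \<forall>j\<in>{1..m}. \<forall>T\<in>\<T> i.
        A i j = card {T' \<in> \<T> j. T' \<subseteq> quot_parent N c S `` T})"

definition red_incidence_matrix ::
    "nat \<Rightarrow> (nat \<Rightarrow> real) \<Rightarrow> (nat \<Rightarrow> 'p \<Rightarrow> 'p) \<Rightarrow> nat \<Rightarrow> (nat \<Rightarrow> nat list set set) \<Rightarrow>
     (nat \<Rightarrow> nat \<Rightarrow> nat) \<Rightarrow> bool" where
  "red_incidence_matrix N c S n \<t> B \<longleftrightarrow>
     (\<forall>i\<in>{1..n}. \<forall>j\<in>{1..n}. \<forall>x\<in>\<t> i. B i j = card {y \<in> \<t> j. (x, y) \<in> red_parent N c S})"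

definition class_representation ::
    "nat \<Rightarrow> nat \<Rightarrow> (nat \<Rightarrow> 'v set set) \<Rightarrow> (nat \<Rightarrow> 'v set) \<Rightarrow> (nat \<Rightarrow> nat \<Rightarrow> nat) \<Rightarrow> bool" where
  "class_representation m n \<T> \<t> u \<longleftrightarrow>
     (\<forall>i\<in>{1..m}. \<forall>j\<in>{1..n}. \<forall>T\<in>\<T> i. u i j = card {x \<in> T. x \<in> \<t> j})"


subsection \<open>Rearrangeable matrices\<close>

definition rearrangeable ::
    "nat \<Rightarrow> nat \<Rightarrow> (nat \<Rightarrow> nat \<Rightarrow> nat) \<Rightarrow> (nat \<Rightarrow> nat \<Rightarrow> nat) \<Rightarrow> (nat \<Rightarrow> nat \<Rightarrow> nat) \<Rightarrow> bool" where
  "rearrangeable m n B u A \<longleftrightarrow>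
     (\<forall>i\<in>{1..m}. \<exists>C :: nat \<Rightarrow> nat \<Rightarrow> nat.
        let p = (\<Sum>j = 1..n. u i j) in
          (\<forall>j\<in>{1..m}. A i j = (\<Sum>s = 1..p. C s j)) \<and>
          (\<forall>j\<in>{1..n}.
             card {s \<in> {1..p}. \<forall>k\<in>{1..n}. (\<Sum>l = 1..m. C s l * u l k) = B j k} = u i j))"


subsection \<open>Hyperbolic graphs, near-isometries and boundaries\<close>

text \<open>
  A graph is a vertex set \<open>V\<close> with a symmetric relation \<open>E \<subseteq> V \<times> V\<close>. The graph distance is
  meaningful for connected graphs only.
\<close>

definition graph_dist :: "('v \<times> 'v) set \<Rightarrow> 'v \<Rightarrow> 'v \<Rightarrow> nat" where
  "graph_dist E x y = (LEAST k. (x, y) \<in> E ^^ k)"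

definition gromov_product :: "('v \<times> 'v) set \<Rightarrow> 'v \<Rightarrow> 'v \<Rightarrow> 'v \<Rightarrow> real" where
  "gromov_product E v x y =
     (real (graph_dist E v x) + real (graph_dist E v y) - real (graph_dist E x y)) / 2"

definition hyperbolic_graph :: "'v set \<Rightarrow> ('v \<times> 'v) set \<Rightarrow> 'v \<Rightarrow> real \<Rightarrow> bool" where
  "hyperbolic_graph V E v \<delta> \<longleftrightarrow>
     0 \<le> \<delta> \<and>
     (\<forall>x\<in>V. \<forall>y\<in>V. \<forall>z\<in>V.
        gromov_product E v x y \<ge> min (gromov_product E v x z) (gromov_product E v z y) - \<delta>)"

definition near_isometry ::
    "'v set \<Rightarrow> ('v \<times> 'v) set \<Rightarrow> 'w set \<Rightarrow> ('w \<times> 'w) set \<Rightarrow> ('v \<Rightarrow> 'w) \<Rightarrow> bool" where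
  "near_isometry V E V' E' \<sigma> \<longleftrightarrow>
     bij_betw \<sigma> V V' \<and>
     (\<exists>L>0. \<forall>x\<in>V. \<forall>y\<in>V.
        \<bar>real (graph_dist E' (\<sigma> x) (\<sigma> y)) - real (graph_dist E x y)\<bar> < L)"

definition visual_rho :: "('v \<times> 'v) set \<Rightarrow> 'v \<Rightarrow> real \<Rightarrow> 'v \<Rightarrow> 'v \<Rightarrow> real" where
  "visual_rho E v a x y = (if x = y then 0 else exp (- a * gromov_product E v x y))"

definition rho_Cauchy ::
    "'v set \<Rightarrow> ('v \<times> 'v) set \<Rightarrow> 'v \<Rightarrow> real \<Rightarrow> (nat \<Rightarrow> 'v) set" where
  "rho_Cauchy V E v a =
     {x. range x \<subseteq> V \<and> (\<forall>\<epsilon>>0. \<exists>M. \<forall>k\<ge>M. \<forall>l\<ge>M. visual_rho E v a (x k) (x l) < \<epsilon>)}"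

definition rho_completion ::
    "'v set \<Rightarrow> ('v \<times> 'v) set \<Rightarrow> 'v \<Rightarrow> real \<Rightarrow> (nat \<Rightarrow> 'v) set set" where
  "rho_completion V E v a =
     rho_Cauchy V E v a //
       {(x, y). x \<in> rho_Cauchy V E v a \<and> y \<in> rho_Cauchy V E v a \<and>
                (\<lambda>k. visual_rho E v a (x k) (y k)) \<longlonglongrightarrow> 0}"

text \<open>A vertex is identified with the class of the constant sequence at that vertex.\<close>

definition hyp_boundary ::
    "'v set \<Rightarrow> ('v \<times> 'v) set \<Rightarrow> 'v \<Rightarrow> real \<Rightarrow> (nat \<Rightarrow> 'v) set set" where
  "hyp_boundary V E v a = {\<xi> \<in> rho_completion V E v a. \<forall>x\<in>V. (\<lambda>_. x) \<notin> \<xi>}"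

text \<open>
  The function \<open>visual_rho\<close> is only comparable to a metric, so \<open>visual_rho\<close> along two
  representing sequences need not converge. Up to multiplicative constants all choices of
  an extension to the boundary agree; the supremum of the upper limits over all
  representing sequences is used here. The values lie in \<open>[0, 1]\<close>.
\<close>

definition boundary_rho ::
    "('v \<times> 'v) set \<Rightarrow> 'v \<Rightarrow> real \<Rightarrow> (nat \<Rightarrow> 'v) set \<Rightarrow> (nat \<Rightarrow> 'v) set \<Rightarrow> real" where
  "boundary_rho E v a \<xi> \<eta> =
     real_of_ereal
       (SUP x\<in>\<xi>. SUP y\<in>\<eta>. limsup (\<lambda>k. ereal (visual_rho E v a (x k) (y k))))"

text \<open>
  The distance functions are not required to be metrics, since \<open>boundary_rho\<close> is only
  comparable to one; replacing either by a comparable metric does not affect the notion.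
\<close>

definition lipschitz_equivalent ::
    "'x set \<Rightarrow> ('x \<Rightarrow> 'x \<Rightarrow> real) \<Rightarrow> 'y set \<Rightarrow> ('y \<Rightarrow> 'y \<Rightarrow> real) \<Rightarrow> bool" where
  "lipschitz_equivalent M D M' D' \<longleftrightarrow>
     (\<exists>\<phi>. bij_betw \<phi> M M' \<and>
        (\<exists>L>0. \<forall>\<xi>\<in>M. \<forall>\<eta>\<in>M.
           D \<xi> \<eta> / L \<le> D' (\<phi> \<xi>) (\<phi> \<eta>) \<and> D' (\<phi> \<xi>) (\<phi> \<eta>) \<le> L * D \<xi> \<eta>))"

end

theory Submission
  imports Defs
begin

text \<open>
  The quotient graph and the reduced tree have the same vertices and the same levels, and in both
  of them a geodesic between two vertices essentially climbs from each of them until the two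
  ascents meet. In the reduced tree the ascents meet in a common
  ancestor. In the quotient graph they may be considered to have met as soon as they reach the
  same horizontal component: parents of horizontally adjacent vertices are equal or horizontally
  adjacent, so components form a tree under the offspring relation, and the distance in that
  tree is a lower bound for the distance in the graph; conversely the detour inside a component
  is bounded, because a component of the \<open>i\<close>-th class has exactly \<open>\<Sum>\<^sub>j u i j\<close> vertices
  (\<open>path_length_ge\<close>, \<open>graph_dist_upper\<close>).

  It therefore suffices to find a bijection \<open>\<sigma>\<close> of the vertices, preserving levels, which maps
  every component below the root into one family of siblings of the reduced tree, in such a way
  that the parent of these siblings is the image of a vertex of the parent component. Then the meeting levels in
  the two graphs differ by at most one (\<open>rearranged_parents_imp_near_isometry\<close>).

  Rearrangeability is exactly what allows one to build such a \<open>\<sigma>\<close> from each level to the next,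
  with the additional property that \<open>\<sigma>\<close> preserves the class of a vertex in the reduced tree. Let
  \<open>T\<close> be a component. The rows of the matrix \<open>C\<close> distribute the components formed by the
  offspring of \<open>T\<close> among the vertices of \<open>T\<close>, so that the components given to a vertex \<open>x\<close> of
  \<open>T\<close> have together as many vertices of each class as there are offspring of \<open>x\<close>
  in the reduced tree (\<open>rearranged_offspring\<close>). Since \<open>\<sigma> x\<close> has the class of \<open>x\<close>, these vertices
  can be mapped bijectively to the offspring of \<open>\<sigma> x\<close> (\<open>exists_level_bijection\<close>).

  The row condition only counts, for each class \<open>j\<close>, the rows of \<open>C\<close> that reproduce the \<open>j\<close>-th
  row of \<open>B\<close>. That every row of \<open>C\<close> is counted, and only once, depends on the rows of \<open>B\<close> being
  distinct. They are: two vertices with equally many offspring in every class have isomorphic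
  subtrees, obtained by gluing isomorphisms of the subtrees of their offspring
  (\<open>iso_between_children\<close>).

  Finally, \<open>\<sigma>\<close> fixes the root, so it changes Gromov products by a bounded amount and
  \<open>visual_rho\<close> by a bounded factor. Hence composition with \<open>\<sigma>\<close> identifies Cauchy sequences,
  their equivalence, and the boundaries with comparable distances
  (\<open>near_isometry_imp_lipschitz_equivalent_boundaries\<close>).
\<close>


section \<open>Matching finite sets fibre by fibre\<close>

text \<open>
  The fibres of \<open>f\<close> and \<open>g\<close> over a common index are matched separately. All the choices in the
  construction of the near-isometry are instances: vertices against rows of a matrix, components
  against entries of a matrix, and vertices against vertices of the same type.
\<close>

lemma bij_betw_matching_fibres:
  assumes "finite A" "finite B"
    and fibres: "\<And>i. card {a \<in> A. f a = i} = card {b \<in> B. g b = i}"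
  shows "\<exists>h. bij_betw h A B \<and> (\<forall>a\<in>A. g (h a) = f a)"
proof -
  have "\<forall>i. \<exists>h. bij_betw h {a \<in> A. f a = i} {b \<in> B. g b = i}"
    using assms by (intro allI finite_same_card_bij) auto
  then obtain h where h: "\<And>i. bij_betw (h i) {a \<in> A. f a = i} {b \<in> B. g b = i}"
    by metis
  have h_in: "h (f a) a \<in> B \<and> g (h (f a) a) = f a" if "a \<in> A" for a
    using bij_betwE[OF h[of "f a"]] that by auto
  have "inj_on (\<lambda>a. h (f a) a) A"
  proof (rule inj_onI)
    fix a b assume ab: "a \<in> A" "b \<in> A" "h (f a) a = h (f b) b"
    then have "f a = f b" using h_in by metis
    with ab show "a = b"
      using bij_betw_imp_inj_on[OF h[of "f a"]] by (auto dest: inj_onD)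
  qed
  moreover have "b \<in> (\<lambda>a. h (f a) a) ` A" if "b \<in> B" for b
  proof -
    have "b \<in> h (g b) ` {a \<in> A. f a = g b}"
      using bij_betw_imp_surj_on[OF h[of "g b"]] that by auto
    then obtain a where "b = h (g b) a" "a \<in> A" "f a = g b" by blast
    then have "b = h (f a) a" by simp
    then show ?thesis using \<open>a \<in> A\<close> by (rule image_eqI)
  qed
  ultimately have "bij_betw (\<lambda>a. h (f a) a) A B"
    using h_in by (auto simp: bij_betw_def)
  with h_in show ?thesis by blast
qed


section \<open>Graph distance through common ancestors\<close>

lemma graph_dist_le: "(x, y) \<in> E ^^ k \<Longrightarrow> graph_dist E x y \<le> k"
  unfolding graph_dist_def by (rule Least_le)

lemma relpow_graph_dist: "(x, y) \<in> E ^^ k \<Longrightarrow> (x, y) \<in> E ^^ graph_dist E x y"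
  unfolding graph_dist_def by (rule LeastI)

text \<open>
  A common framework for the quotient graph, with \<open>Q\<close> the relation of lying in the same
  horizontal component, and for the reduced tree, with \<open>Q\<close> the identity. An edge either stays
  inside a class of \<open>Q\<close> or joins such a class to the class of the parents, and \<open>M\<close> bounds the
  detours needed inside a class.
\<close>

locale ancestral_graph =
  fixes V :: "'v set" and lev :: "'v \<Rightarrow> nat" and par :: "'v \<Rightarrow> 'v"
    and Q E :: "('v \<times> 'v) set" and M :: nat
  assumes root_Q: "\<lbrakk>x \<in> V; y \<in> V; lev x = 0; lev y = 0\<rbrakk> \<Longrightarrow> (x, y) \<in> Q"
    and par_V: "\<lbrakk>x \<in> V; 0 < lev x\<rbrakk> \<Longrightarrow> par x \<in> V"
    and lev_par: "\<lbrakk>x \<in> V; 0 < lev x\<rbrakk> \<Longrightarrow> lev (par x) = lev x - 1"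
    and Q_equiv: "equiv V Q"
    and Q_lev: "(x, y) \<in> Q \<Longrightarrow> lev x = lev y"
    and Q_par: "\<lbrakk>(x, y) \<in> Q; 0 < lev x\<rbrakk> \<Longrightarrow> (par x, par y) \<in> Q"
    and E_cases: "(x, y) \<in> E \<Longrightarrow>
      (x, y) \<in> Q \<or> 0 < lev y \<and> y \<in> V \<and> (x, par y) \<in> Q \<or> 0 < lev x \<and> x \<in> V \<and> (par x, y) \<in> Q"
    and E_par: "\<lbrakk>x \<in> V; 0 < lev x\<rbrakk> \<Longrightarrow> (x, par x) \<in> E \<and> (par x, x) \<in> E"
    and Q_path: "(x, y) \<in> Q \<Longrightarrow> \<exists>k\<le>M. (x, y) \<in> E ^^ k"
begin

text \<open>
  \<open>common j x y\<close> says that the two ascents have met at level \<open>j\<close>. A relation is more convenient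
  here than the highest such level: the bounds on the distance below only ask for some \<open>j\<close>.
\<close>

definition common :: "nat \<Rightarrow> 'v \<Rightarrow> 'v \<Rightarrow> bool" where
  "common j x y \<longleftrightarrow> j \<le> lev x \<and> j \<le> lev y \<and>
     ((par ^^ (lev x - j)) x, (par ^^ (lev y - j)) y) \<in> Q"

lemma Q_V: "(x, y) \<in> Q \<Longrightarrow> x \<in> V \<and> y \<in> V"
  using Q_equiv by (auto simp: equiv_def refl_on_def)

lemma Q_trans: "(x, y) \<in> Q \<Longrightarrow> (y, z) \<in> Q \<Longrightarrow> (x, z) \<in> Q"
  using Q_equiv by (auto simp: equiv_def dest: transD)

lemma par_pow: "\<lbrakk>x \<in> V; i \<le> lev x\<rbrakk> \<Longrightarrow> (par ^^ i) x \<in> V \<and> lev ((par ^^ i) x) = lev x - i"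
  by (induction i) (auto simp: par_V lev_par)

lemma Q_par_pow: "\<lbrakk>(x, y) \<in> Q; i \<le> lev x\<rbrakk> \<Longrightarrow> ((par ^^ i) x, (par ^^ i) y) \<in> Q"
  by (induction i) (use Q_V par_pow in \<open>auto intro!: Q_par\<close>)

lemma common_0: "\<lbrakk>x \<in> V; y \<in> V\<rbrakk> \<Longrightarrow> common 0 x y"
  unfolding common_def using par_pow by (auto intro: root_Q)

lemma common_Suc: assumes "common (Suc j) x y" "x \<in> V" "y \<in> V" shows "common j x y"
proof -
  have j: "Suc j \<le> lev x" "Suc j \<le> lev y" and
    Q: "((par ^^ (lev x - Suc j)) x, (par ^^ (lev y - Suc j)) y) \<in> Q"
    using assms(1) by (auto simp: common_def)
  have eq: "lev x - j = Suc (lev x - Suc j)" "lev y - j = Suc (lev y - Suc j)"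
    using j by auto
  have "0 < lev ((par ^^ (lev x - Suc j)) x)"
    using par_pow[OF \<open>x \<in> V\<close>, of "lev x - Suc j"] j by simp
  from Q_par[OF Q this] show ?thesis
    unfolding common_def eq using j by simp
qed

lemma common_Q: "\<lbrakk>(x, z) \<in> Q; common j z y\<rbrakk> \<Longrightarrow> common j x y"
  unfolding common_def using Q_lev[of x z] Q_par_pow[of x z "lev z - j"]
  by (auto intro: Q_trans)

lemma common_par:
  assumes "x \<in> V" "0 < lev x"
  shows "common j (par x) y \<longleftrightarrow> j \<le> lev x - 1 \<and> common j x y"
proof -
  have "(par ^^ (lev x - j)) x = (par ^^ (lev x - 1 - j)) (par x)" if "j \<le> lev x - 1"
  proof -
    have "lev x - j = Suc (lev x - 1 - j)" using that assms by auto
    then show ?thesis by (simp only: funpow_Suc_right comp_def)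
  qed
  then show ?thesis using assms by (auto simp: common_def lev_par)
qed

text \<open>
  Follow the quantity \<open>lev x + lev y - 2 * j\<close>, for a suitable common level \<open>j\<close>, along a path
  ending in \<open>y\<close>: a horizontal step leaves it unchanged and a vertical step changes it by at most
  one. The level \<open>j\<close> has to be lowered only when the path climbs out of a vertex at level \<open>j\<close>
  itself.
\<close>

lemma path_length_ge:
  "\<lbrakk>(x, y) \<in> E ^^ k; x \<in> V; y \<in> V\<rbrakk> \<Longrightarrow> \<exists>j. common j x y \<and> lev x + lev y \<le> k + 2 * j"
proof (induction k arbitrary: x)
  case 0
  then have "common (lev x) x y" using Q_equiv by (auto simp: common_def equiv_def refl_on_def)
  with 0 show ?case by (intro exI[of _ "lev x"]) auto
next
  case (Suc k)
  then obtain z where z: "(x, z) \<in> E" "(z, y) \<in> E ^^ k" by (meson relpow_Suc_D2)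
  have "z \<in> V" using E_cases[OF z(1)] Q_V by auto
  then obtain j where j: "common j z y" "lev z + lev y \<le> k + 2 * j"
    using Suc.IH[OF z(2)] Suc.prems by auto
  from E_cases[OF z(1)] consider "(x, z) \<in> Q" | "0 < lev z" "(x, par z) \<in> Q"
    | "0 < lev x" "(par x, z) \<in> Q" by auto
  then show ?case
  proof cases
    case 1
    with j show ?thesis using common_Q[OF 1] Q_lev[OF 1] by (intro exI[of _ j]) auto
  next
    case 2
    have lx: "lev x = lev z - 1" using Q_lev[OF 2(2)] lev_par \<open>z \<in> V\<close> 2 by auto
    show ?thesis
    proof (cases "j \<le> lev x")
      case True
      then have "common j x y"
        using common_Q[OF 2(2)] common_par[OF \<open>z \<in> V\<close> 2(1)] j lx by auto
      with j lx show ?thesis by (intro exI[of _ j]) auto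
    next
      case False
      \<comment> \<open>The next vertex is itself the meeting point, which thus moves up by one level.\<close>
      then have jz: "j = lev z" using j lx by (auto simp: common_def)
      then have "common (j - 1) z y" using common_Suc[of "j - 1"] j 2 \<open>z \<in> V\<close> Suc.prems by auto
      then have "common (j - 1) x y"
        using common_Q[OF 2(2)] common_par[OF \<open>z \<in> V\<close> 2(1)] jz by auto
      with j lx jz 2(1) show ?thesis by (intro exI[of _ "j - 1"]) auto
    qed
  next
    case 3
    have lx: "lev z = lev x - 1" using Q_lev[OF 3(2)] lev_par Suc.prems 3 by auto
    have "common j x y"
      using common_Q[OF 3(2) j(1)] common_par[OF \<open>x \<in> V\<close> 3(1)] by auto
    with j lx 3(1) show ?thesis by (intro exI[of _ j]) auto
  qed
qed

lemma par_path: "\<lbrakk>x \<in> V; i \<le> lev x\<rbrakk> \<Longrightarrow> (x, (par ^^ i) x) \<in> E ^^ i \<and> ((par ^^ i) x, x) \<in> E ^^ i"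
proof (induction i)
  case (Suc i)
  let ?p = "(par ^^ i) x"
  have "(?p, par ?p) \<in> E" "(par ?p, ?p) \<in> E"
    using E_par[of ?p] par_pow[of x i] Suc.prems by auto
  with Suc show ?case by (auto intro: relpow_Suc_I2 relpow_Suc_I simp del: relpow.simps)
qed auto

text \<open>
  Climb from \<open>x\<close> to level \<open>j\<close>, cross over inside the class of \<open>Q\<close>, and descend to \<open>y\<close>.
\<close>

lemma common_path:
  assumes "common j x y" "x \<in> V" "y \<in> V"
  shows "\<exists>k. (x, y) \<in> E ^^ k \<and> k + 2 * j \<le> lev x + lev y + M"
proof -
  let ?p = "(par ^^ (lev x - j)) x" and ?q = "(par ^^ (lev y - j)) y"
  have j: "j \<le> lev x" "j \<le> lev y" "(?p, ?q) \<in> Q" using assms by (auto simp: common_def)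
  obtain i where i: "i \<le> M" "(?p, ?q) \<in> E ^^ i" using Q_path j by blast
  have "(x, ?p) \<in> E ^^ (lev x - j)" "(?q, y) \<in> E ^^ (lev y - j)"
    using par_path assms by auto
  then have "(x, y) \<in> E ^^ (lev x - j + (i + (lev y - j)))"
    using i by (auto simp: relpow_add)
  then show ?thesis using i j by (intro exI) auto
qed

lemma graph_dist_upper:
  assumes "common j x y" "x \<in> V" "y \<in> V"
  shows "graph_dist E x y + 2 * j \<le> lev x + lev y + M"
proof -
  obtain k where "(x, y) \<in> E ^^ k" "k + 2 * j \<le> lev x + lev y + M"
    using common_path[OF assms] by blast
  then show ?thesis using graph_dist_le[of x y k E] by linarith
qed

lemma graph_dist_lower:
  assumes "x \<in> V" "y \<in> V"
  shows "\<exists>j. common j x y \<and> lev x + lev y \<le> graph_dist E x y + 2 * j"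
proof -
  obtain k where "(x, y) \<in> E ^^ k" using common_path[OF common_0[OF assms] assms] by blast
  from path_length_ge[OF relpow_graph_dist[OF this] assms] show ?thesis .
qed

end


section \<open>Near-isometries and hyperbolic boundaries\<close>

text \<open>
  A Gromov product is half a signed sum of three distances, each of which is distorted by less
  than \<open>L\<close>.
\<close>

lemma near_isometry_gromov_product:
  assumes bd: "\<forall>x\<in>V. \<forall>y\<in>V. \<bar>real (graph_dist E' (\<sigma> x) (\<sigma> y)) - real (graph_dist E x y)\<bar> < L"
    and "v \<in> V" "x \<in> V" "y \<in> V"
  shows "\<bar>gromov_product E' (\<sigma> v) (\<sigma> x) (\<sigma> y) - gromov_product E v x y\<bar> \<le> 2 * L"
proof -
  have 1: "\<bar>real (graph_dist E' (\<sigma> v) (\<sigma> x)) - real (graph_dist E v x)\<bar> < L"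
    "\<bar>real (graph_dist E' (\<sigma> v) (\<sigma> y)) - real (graph_dist E v y)\<bar> < L"
    "\<bar>real (graph_dist E' (\<sigma> x) (\<sigma> y)) - real (graph_dist E x y)\<bar> < L"
    using assms by auto
  then show ?thesis unfolding gromov_product_def by argo
qed

lemma visual_rho_near_isometry:
  assumes inj: "inj_on \<sigma> V" and a: "0 \<le> a"
    and gp: "\<bar>gromov_product E' (\<sigma> v) (\<sigma> x) (\<sigma> y) - gromov_product E v x y\<bar> \<le> L"
    and "x \<in> V" "y \<in> V"
  shows "visual_rho E' (\<sigma> v) a (\<sigma> x) (\<sigma> y) \<le> exp (a * L) * visual_rho E v a x y"
    and "visual_rho E v a x y \<le> exp (a * L) * visual_rho E' (\<sigma> v) a (\<sigma> x) (\<sigma> y)"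
proof -
  have eq: "\<sigma> x = \<sigma> y \<longleftrightarrow> x = y" using assms by (auto dest: inj_onD)
  have "- a * gromov_product E' (\<sigma> v) (\<sigma> x) (\<sigma> y) \<le> a * L + - a * gromov_product E v x y"
    "- a * gromov_product E v x y \<le> a * L + - a * gromov_product E' (\<sigma> v) (\<sigma> x) (\<sigma> y)"
    using mult_left_mono[of "gromov_product E v x y - gromov_product E' (\<sigma> v) (\<sigma> x) (\<sigma> y)" L a]
      mult_left_mono[of "gromov_product E' (\<sigma> v) (\<sigma> x) (\<sigma> y) - gromov_product E v x y" L a]
      gp a by (auto simp: algebra_simps)
  then show "visual_rho E' (\<sigma> v) a (\<sigma> x) (\<sigma> y) \<le> exp (a * L) * visual_rho E v a x y"
    "visual_rho E v a x y \<le> exp (a * L) * visual_rho E' (\<sigma> v) a (\<sigma> x) (\<sigma> y)"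
    unfolding visual_rho_def using eq by (auto simp flip: exp_add)
qed

text \<open>
  If one of the values is infinite, then so is the other, with the same sign, and
  \<open>real_of_ereal\<close> maps both to zero. This allows values of \<open>boundary_rho\<close> to be compared through
  the suprema that define them.
\<close>

lemma real_of_ereal_comparable:
  assumes C: "0 < C" and "p \<le> ereal C * q" "q \<le> ereal C * p"
  shows "real_of_ereal p / C \<le> real_of_ereal q \<and> real_of_ereal q \<le> C * real_of_ereal p"
  using assms by (cases p; cases q) (auto simp: field_simps)

lemma boundary_rho_le:
  assumes C: "0 < C"
    and le: "\<And>x y k. x \<in> \<xi> \<Longrightarrow> y \<in> \<eta> \<Longrightarrow> f' (\<Phi> x k) (\<Phi> y k) \<le> C * f (x k) (y k)"
  shows "(SUP x\<in>\<Phi> ` \<xi>. SUP y\<in>\<Phi> ` \<eta>. limsup (\<lambda>k. ereal (f' (x k) (y k))))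
    \<le> ereal C * (SUP x\<in>\<xi>. SUP y\<in>\<eta>. limsup (\<lambda>k. ereal (f (x k) (y k))))"
    (is "?l \<le> _ * ?r")
proof -
  have "limsup (\<lambda>k. ereal (f' (\<Phi> x k) (\<Phi> y k))) \<le> ereal C * ?r" if "x \<in> \<xi>" "y \<in> \<eta>" for x y
  proof -
    have "limsup (\<lambda>k. ereal (f' (\<Phi> x k) (\<Phi> y k))) \<le> limsup (\<lambda>k. ereal C * ereal (f (x k) (y k)))"
      using le that by (intro Limsup_mono always_eventually) auto
    also have "\<dots> = ereal C * limsup (\<lambda>k. ereal (f (x k) (y k)))"
      using C by (intro Limsup_ereal_mult_left) auto
    also have "\<dots> \<le> ereal C * ?r"
      using C that by (intro ereal_mult_left_mono SUP_upper2[of x] SUP_upper2[of y]) auto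
    finally show ?thesis .
  qed
  then show ?thesis by (auto intro!: SUP_least simp: image_image)
qed

text \<open>
  A bounded additive error in the Gromov product becomes the bounded factor \<open>C\<close> in \<open>visual_rho\<close>.
  Being Cauchy, being equivalent, and converging to a vertex are all insensitive to such a
  factor, so the bijection of sequences \<open>x \<mapsto> \<sigma> \<circ> x\<close> maps the completion class by class onto the
  other completion.
\<close>

theorem near_isometry_imp_lipschitz_equivalent_boundaries:
  assumes ni: "near_isometry V E V' E' \<sigma>" and v: "v \<in> V" and a: "0 < a"
  shows "lipschitz_equivalent (hyp_boundary V E v a) (boundary_rho E v a)
           (hyp_boundary V' E' (\<sigma> v) a) (boundary_rho E' (\<sigma> v) a)"
proof -
  obtain L where bij: "bij_betw \<sigma> V V'" and L: "0 < L" and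
    bd: "\<forall>x\<in>V. \<forall>y\<in>V. \<bar>real (graph_dist E' (\<sigma> x) (\<sigma> y)) - real (graph_dist E x y)\<bar> < L"
    using ni by (auto simp: near_isometry_def)
  have inj: "inj_on \<sigma> V" and surj: "\<sigma> ` V = V'" using bij by (auto simp: bij_betw_def)
  define C where "C = exp (a * (2 * L))"
  have C: "0 < C" by (simp add: C_def)
  let ?f = "visual_rho E v a" and ?f' = "visual_rho E' (\<sigma> v) a"
  have le: "?f' (\<sigma> x) (\<sigma> y) \<le> C * ?f x y" "?f x y \<le> C * ?f' (\<sigma> x) (\<sigma> y)"
    if "x \<in> V" "y \<in> V" for x y
    using visual_rho_near_isometry[OF inj _ near_isometry_gromov_product[OF bd v]] a that
    by (auto simp: C_def)
  have f0: "0 \<le> ?f x y" "0 \<le> ?f' x' y'" for x y x' y' by (auto simp: visual_rho_def)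
  define \<Phi> where "\<Phi> = (\<lambda>x :: nat \<Rightarrow> 'a. \<sigma> \<circ> x)"
  define S where "S = {x :: nat \<Rightarrow> 'a. range x \<subseteq> V}"
  define S' where "S' = {x :: nat \<Rightarrow> 'b. range x \<subseteq> V'}"
  have \<Phi>_inj: "inj_on \<Phi> S"
  proof (rule inj_onI)
    fix x y assume xy: "x \<in> S" "y \<in> S" "\<Phi> x = \<Phi> y"
    have "x k = y k" for k
    proof (rule inj_onD[OF inj])
      show "\<sigma> (x k) = \<sigma> (y k)" using fun_cong[OF xy(3), of k] by (simp add: \<Phi>_def)
    qed (use xy in \<open>auto simp: S_def\<close>)
    then show "x = y" by auto
  qed
  have \<Phi>_surj: "\<Phi> ` S = S'"
  proof
    show "\<Phi> ` S \<subseteq> S'" using surj by (auto simp: S_def S'_def \<Phi>_def)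
    show "S' \<subseteq> \<Phi> ` S"
    proof
      fix y assume "y \<in> S'"
      then have "y = \<Phi> (inv_into V \<sigma> \<circ> y)" "inv_into V \<sigma> \<circ> y \<in> S"
        using surj by (auto simp: S_def S'_def \<Phi>_def f_inv_into_f inv_into_into image_subset_iff fun_eq_iff)
      then show "y \<in> \<Phi> ` S" by blast
    qed
  qed
  let ?Cy = "rho_Cauchy V E v a" and ?Cy' = "rho_Cauchy V' E' (\<sigma> v) a"
  have small: "(\<forall>\<epsilon>>0. \<exists>M. \<forall>k\<ge>M. \<forall>l\<ge>M. g' k l < \<epsilon>)"
    if g: "\<forall>\<epsilon>>0. \<exists>M. \<forall>k\<ge>M. \<forall>l\<ge>M. g k l < \<epsilon>" "\<And>k l. g' k l \<le> C * g k l"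
    for g g' :: "nat \<Rightarrow> nat \<Rightarrow> real"
  proof (intro allI impI)
    fix \<epsilon> :: real assume "0 < \<epsilon>"
    then obtain M where "\<forall>k\<ge>M. \<forall>l\<ge>M. g k l < \<epsilon> / C" using g(1) C by (meson divide_pos_pos)
    then have "\<forall>k\<ge>M. \<forall>l\<ge>M. C * g k l < \<epsilon>" using C by (auto simp: field_simps)
    then show "\<exists>M. \<forall>k\<ge>M. \<forall>l\<ge>M. g' k l < \<epsilon>" using g(2) by (meson le_less_trans)
  qed
  have Cy: "\<Phi> x \<in> ?Cy' \<longleftrightarrow> x \<in> ?Cy" if "x \<in> S" for x
  proof -
    have xV: "x k \<in> V" for k using that by (auto simp: S_def)
    have "range x \<subseteq> V" "range (\<Phi> x) \<subseteq> V'" using that \<Phi>_surj by (auto simp: S_def S'_def)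
    moreover have "(\<forall>\<epsilon>>0. \<exists>M. \<forall>k\<ge>M. \<forall>l\<ge>M. ?f' (\<Phi> x k) (\<Phi> x l) < \<epsilon>) \<longleftrightarrow>
        (\<forall>\<epsilon>>0. \<exists>M. \<forall>k\<ge>M. \<forall>l\<ge>M. ?f (x k) (x l) < \<epsilon>)"
      using small[of "\<lambda>k l. ?f (x k) (x l)" "\<lambda>k l. ?f' (\<Phi> x k) (\<Phi> x l)"]
        small[of "\<lambda>k l. ?f' (\<Phi> x k) (\<Phi> x l)" "\<lambda>k l. ?f (x k) (x l)"] le[OF xV xV]
      by (auto simp: \<Phi>_def)
    ultimately show ?thesis by (simp add: rho_Cauchy_def)
  qed
  have CyS: "?Cy \<subseteq> S" "?Cy' \<subseteq> S'" by (auto simp: rho_Cauchy_def S_def S'_def)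
  have Cy_im: "\<Phi> ` ?Cy = ?Cy'"
  proof (intro equalityI subsetI)
    fix y assume y: "y \<in> ?Cy'"
    then have "y \<in> \<Phi> ` S" using CyS(2) \<Phi>_surj by blast
    then obtain x where x: "y = \<Phi> x" "x \<in> S" by (rule imageE)
    then show "y \<in> \<Phi> ` ?Cy" using Cy y by simp
  next
    fix y assume "y \<in> \<Phi> ` ?Cy"
    then obtain x where "y = \<Phi> x" "x \<in> ?Cy" by (rule imageE)
    then show "y \<in> ?Cy'" using Cy CyS(1) by (simp add: subset_iff)
  qed
  define r where "r = {(x, y). x \<in> ?Cy \<and> y \<in> ?Cy \<and> (\<lambda>k. ?f (x k) (y k)) \<longlonglongrightarrow> 0}"
  define r' where "r' = {(x, y). x \<in> ?Cy' \<and> y \<in> ?Cy' \<and> (\<lambda>k. ?f' (x k) (y k)) \<longlonglongrightarrow> 0}"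
  have lim: "g' \<longlonglongrightarrow> 0" if "g \<longlonglongrightarrow> 0" "\<And>k. g' k \<le> C * g k" "\<And>k. 0 \<le> g' k" for g g' :: "nat \<Rightarrow> real"
  proof (rule tendsto_sandwich[of "\<lambda>_. 0" _ _ "\<lambda>k. C * g k"])
    show "(\<lambda>k. C * g k) \<longlonglongrightarrow> 0" using tendsto_mult_right_zero[OF that(1)] .
  qed (use that in auto)
  have r: "(\<Phi> x, \<Phi> y) \<in> r' \<longleftrightarrow> (x, y) \<in> r" if "x \<in> S" "y \<in> S" for x y
  proof -
    have xV: "x k \<in> V" "y k \<in> V" for k using that by (auto simp: S_def)
    have "(\<lambda>k. ?f' (\<Phi> x k) (\<Phi> y k)) \<longlonglongrightarrow> 0 \<longleftrightarrow> (\<lambda>k. ?f (x k) (y k)) \<longlonglongrightarrow> 0"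
      using lim[of "\<lambda>k. ?f (x k) (y k)" "\<lambda>k. ?f' (\<Phi> x k) (\<Phi> y k)"]
        lim[of "\<lambda>k. ?f' (\<Phi> x k) (\<Phi> y k)" "\<lambda>k. ?f (x k) (y k)"] le[OF xV] f0
      by (auto simp: \<Phi>_def)
    then show ?thesis using Cy that by (simp add: r_def r'_def)
  qed
  have r_Cy: "r `` {x} \<subseteq> ?Cy" "r' `` {x'} \<subseteq> ?Cy'" for x x' by (auto simp: r_def r'_def)
  have r_im: "\<Phi> ` (r `` {x}) = r' `` {\<Phi> x}" if "x \<in> ?Cy" for x
  proof
    show "\<Phi> ` (r `` {x}) \<subseteq> r' `` {\<Phi> x}" 
    proof
      fix y assume "y \<in> \<Phi> ` (r `` {x})"
      then obtain z where z: "z \<in> r `` {x}" "y = \<Phi> z" by (rule imageE)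
      then have "z \<in> ?Cy" using r_Cy(1) by blast
      then show "y \<in> r' `` {\<Phi> x}" using r[of x z] z CyS(1) that by (simp add: subset_iff)
    qed
    show "r' `` {\<Phi> x} \<subseteq> \<Phi> ` (r `` {x})"
    proof
      fix y assume y: "y \<in> r' `` {\<Phi> x}"
      then have "y \<in> \<Phi> ` ?Cy" using r_Cy(2) Cy_im by blast
      then obtain z where z: "y = \<Phi> z" "z \<in> ?Cy" by (rule imageE)
      then have "z \<in> r `` {x}" using y r[of x z] CyS(1) that by (simp add: subset_iff)
      then show "y \<in> \<Phi> ` (r `` {x})" by (rule rev_image_eqI) (fact z(1))
    qed
  qed
  let ?B = "hyp_boundary V E v a" and ?B' = "hyp_boundary V' E' (\<sigma> v) a"
  have B: "?B = {\<xi> \<in> ?Cy // r. \<forall>x\<in>V. (\<lambda>_. x) \<notin> \<xi>}" "?B' = {\<xi> \<in> ?Cy' // r'. \<forall>x\<in>V'. (\<lambda>_. x) \<notin> \<xi>}"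
    by (auto simp: hyp_boundary_def rho_completion_def r_def r'_def)
  have qS: "\<xi> \<subseteq> S" if "\<xi> \<in> ?Cy // r" for \<xi>
    using that order_trans[OF r_Cy(1) CyS(1)] by (auto simp: quotient_def)
  have const: "(\<forall>x\<in>V'. (\<lambda>_. x) \<notin> \<Phi> ` \<xi>) \<longleftrightarrow> (\<forall>x\<in>V. (\<lambda>_. x) \<notin> \<xi>)" if "\<xi> \<subseteq> S" for \<xi>
  proof -
    have "(\<lambda>_. \<sigma> x) \<in> \<Phi> ` \<xi> \<longleftrightarrow> (\<lambda>_. x) \<in> \<xi>" if "x \<in> V" for x
    proof -
      have "(\<lambda>_. \<sigma> x) = \<Phi> (\<lambda>_. x)" "(\<lambda>_. x) \<in> S" using that by (auto simp: \<Phi>_def S_def)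
      then show ?thesis using inj_on_image_mem_iff[OF \<Phi>_inj _ \<open>\<xi> \<subseteq> S\<close>] by simp
    qed
    then show ?thesis unfolding surj[symmetric] by simp
  qed
  have quot_im: "(`) \<Phi> ` (?Cy // r) = ?Cy' // r'"
  proof -
    have "(`) \<Phi> ` (?Cy // r) = (\<lambda>x. \<Phi> ` (r `` {x})) ` ?Cy" by (auto simp: quotient_def)
    also have "\<dots> = (\<lambda>y. r' `` {y}) ` \<Phi> ` ?Cy" unfolding image_image using r_im by (intro image_cong) auto
    also have "\<dots> = ?Cy' // r'" unfolding Cy_im by (auto simp: quotient_def)
    finally show ?thesis .
  qed
  have "bij_betw ((`) \<Phi>) ?B ?B'"
    unfolding bij_betw_def
  proof
    show "inj_on ((`) \<Phi>) ?B"
      using qS inj_on_image_eq_iff[OF \<Phi>_inj] by (auto simp: inj_on_def B)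
    show "(`) \<Phi> ` ?B = ?B'"
    proof (intro equalityI subsetI)
      fix \<zeta> assume "\<zeta> \<in> ?B'"
      then have "\<zeta> \<in> ?Cy' // r'" and no: "\<forall>x\<in>V'. (\<lambda>_. x) \<notin> \<zeta>" by (auto simp only: B)
      then obtain \<xi> where \<xi>: "\<xi> \<in> ?Cy // r" "\<zeta> = \<Phi> ` \<xi>" unfolding quot_im[symmetric] by blast
      then have "\<xi> \<in> ?B" using no const[OF qS] by (simp only: B mem_Collect_eq)
      with \<xi> show "\<zeta> \<in> (`) \<Phi> ` ?B" by blast
    next
      fix \<zeta> assume "\<zeta> \<in> (`) \<Phi> ` ?B"
      then obtain \<xi> where \<xi>: "\<xi> \<in> ?B" "\<zeta> = \<Phi> ` \<xi>" by (rule imageE)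
      then have \<xi>': "\<xi> \<in> ?Cy // r" "\<forall>x\<in>V. (\<lambda>_. x) \<notin> \<xi>" unfolding B(1) by blast+
      then have "\<zeta> \<in> ?Cy' // r'" unfolding \<xi>(2) quot_im[symmetric] by blast
      moreover have "\<forall>x\<in>V'. (\<lambda>_. x) \<notin> \<zeta>" unfolding \<xi>(2) const[OF qS[OF \<xi>'(1)]] by (fact \<xi>'(2))
      ultimately show "\<zeta> \<in> ?B'" unfolding B(2) by blast
    qed
  qed
  moreover have "boundary_rho E v a \<xi> \<eta> / C \<le> boundary_rho E' (\<sigma> v) a (\<Phi> ` \<xi>) (\<Phi> ` \<eta>) \<and>
      boundary_rho E' (\<sigma> v) a (\<Phi> ` \<xi>) (\<Phi> ` \<eta>) \<le> C * boundary_rho E v a \<xi> \<eta>"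
    if "\<xi> \<in> ?B" "\<eta> \<in> ?B" for \<xi> \<eta>
  proof -
    have S: "x k \<in> V" if "x \<in> \<xi> \<union> \<eta>" for x k
      using qS[of \<xi>] qS[of \<eta>] \<open>\<xi> \<in> ?B\<close> \<open>\<eta> \<in> ?B\<close> that unfolding B(1) S_def by blast
    have inv: "inv_into S \<Phi> (\<Phi> x) = x" if "x \<in> \<xi> \<union> \<eta>" for x
      using \<Phi>_inj S[OF that] by (auto simp: S_def intro!: inv_into_f_f)
    have im: "inv_into S \<Phi> ` \<Phi> ` \<xi> = \<xi>" "inv_into S \<Phi> ` \<Phi> ` \<eta> = \<eta>"
      using inv by (force simp: image_image)+
    show ?thesis
      unfolding boundary_rho_def
    proof (rule real_of_ereal_comparable[OF C])
      show "(SUP x\<in>\<xi>. SUP y\<in>\<eta>. limsup (\<lambda>k. ereal (?f (x k) (y k))))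
        \<le> ereal C * (SUP x\<in>\<Phi> ` \<xi>. SUP y\<in>\<Phi> ` \<eta>. limsup (\<lambda>k. ereal (?f' (x k) (y k))))"
        using boundary_rho_le[OF C, of "\<Phi> ` \<xi>" "\<Phi> ` \<eta>" ?f "inv_into S \<Phi>" ?f']
        unfolding im using inv le S by (force simp: \<Phi>_def)
      show "(SUP x\<in>\<Phi> ` \<xi>. SUP y\<in>\<Phi> ` \<eta>. limsup (\<lambda>k. ereal (?f' (x k) (y k))))
        \<le> ereal C * (SUP x\<in>\<xi>. SUP y\<in>\<eta>. limsup (\<lambda>k. ereal (?f (x k) (y k))))"
        using le S by (intro boundary_rho_le[OF C]) (auto simp: \<Phi>_def)
    qed
  qed
  ultimately show ?thesis
    unfolding lipschitz_equivalent_def using C by (intro exI[of _ "(`) \<Phi>"] conjI exI[of _ C]) auto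
qed


section \<open>Layered graphs with a spanning tree\<close>

lemma relpow_mono:
  fixes E F :: "('a \<times> 'a) set"
  shows "E \<subseteq> F \<Longrightarrow> E ^^ k \<subseteq> F ^^ k"
  by (induction k) (simp_all add: relcomp_mono)

text \<open>
  The combinatorial content of the quotient space: levels \<open>L\<close>, parent relation \<open>P\<close>, horizontal
  edges \<open>H\<close>, and a spanning tree \<open>R\<close> inside \<open>P\<close>. The geometry enters only through the assumption
  \<open>P_H\<close>, that neighbouring vertices have neighbouring parents.
\<close>

locale layered_graph =
  fixes L :: "nat \<Rightarrow> 'v set" and P H R :: "('v \<times> 'v) set" and root :: 'v
  assumes L_0: "L 0 = {root}"
    and L_finite: "finite (L i)"
    and L_unique: "\<lbrakk>x \<in> L i; x \<in> L j\<rbrakk> \<Longrightarrow> i = j"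
    and P_levels: "(x, y) \<in> P \<Longrightarrow> \<exists>i. x \<in> L i \<and> y \<in> L (Suc i)"
    and H_levels: "(x, y) \<in> H \<Longrightarrow> \<exists>i. x \<in> L i \<and> y \<in> L i"
    and H_sym: "sym H"
    and P_H: "\<lbrakk>(x, y) \<in> P; (x', y') \<in> P; y = y' \<or> (y, y') \<in> H\<rbrakk> \<Longrightarrow> (x, x') \<in> H\<^sup>*"
    and R_P: "R \<subseteq> P"
    and R_ex1: "y \<in> L (Suc i) \<Longrightarrow> \<exists>!x. (x, y) \<in> R"
begin

definition V :: "'v set" where "V = (\<Union>i. L i)"

definition lev :: "'v \<Rightarrow> nat" where "lev x = (THE i. x \<in> L i)"

definition par :: "'v \<Rightarrow> 'v" where "par y = (THE x. (x, y) \<in> R)"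

text \<open>
  Horizontal edges stay inside a level, so the component of a vertex in its level is its class
  under the reflexive transitive closure of \<open>H\<close>.
\<close>

definition hcomp :: "'v \<Rightarrow> 'v set" where "hcomp x = H\<^sup>* `` {x}"

lemma lev_eq: "x \<in> L i \<Longrightarrow> lev x = i"
  unfolding lev_def using L_unique by blast

lemma L_V: "x \<in> L i \<Longrightarrow> x \<in> V"
  by (auto simp: V_def)

lemma L_lev: "x \<in> V \<Longrightarrow> x \<in> L (lev x)"
  using lev_eq by (auto simp: V_def)

lemma L_iff: "x \<in> L i \<longleftrightarrow> x \<in> V \<and> lev x = i"
  using lev_eq L_lev L_V by blast

lemma R_par: assumes "y \<in> L (Suc i)" shows "(par y, y) \<in> R"
  unfolding par_def using R_ex1[OF assms] by (rule theI')

lemma P_L: "(x, y) \<in> P \<Longrightarrow> y \<in> L (Suc i) \<longleftrightarrow> x \<in> L i"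
  using P_levels[of x y] by (auto simp: L_iff)

lemma R_L: "(x, y) \<in> R \<Longrightarrow> y \<in> L (Suc i) \<longleftrightarrow> x \<in> L i"
  using P_L R_P by blast

lemma R_iff: "(x, y) \<in> R \<longleftrightarrow> y \<in> V \<and> 0 < lev y \<and> x = par y"
proof
  assume *: "(x, y) \<in> R"
  then obtain i where i: "y \<in> L (Suc i)" using P_levels R_P by blast
  with R_par[OF i] R_ex1[OF i] * show "y \<in> V \<and> 0 < lev y \<and> x = par y"
    by (auto simp: L_iff)
next
  assume *: "y \<in> V \<and> 0 < lev y \<and> x = par y"
  then have "y \<in> L (Suc (lev y - 1))" by (simp add: L_iff)
  from R_par[OF this] * show "(x, y) \<in> R" by simp
qed

lemma par_L: "y \<in> L (Suc i) \<Longrightarrow> par y \<in> L i"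
  using R_par R_L by blast

lemma hconn_sym: "(x, y) \<in> H\<^sup>* \<Longrightarrow> (y, x) \<in> H\<^sup>*"
  using sym_rtrancl[OF H_sym] by (auto dest: symD)

lemma hconn_L: "(x, y) \<in> H\<^sup>* \<Longrightarrow> x \<in> L i \<Longrightarrow> y \<in> L i"
proof (induction rule: rtrancl_induct)
  case (step y z)
  then show ?case using H_levels[of y z] by (auto simp: L_iff)
qed

lemma hconn_V: "(x, y) \<in> H\<^sup>* \<Longrightarrow> x \<in> V \<Longrightarrow> y \<in> V \<and> lev y = lev x"
  using hconn_L[of x y "lev x"] by (auto simp: L_iff)

lemma hcomp_eq_iff: "hcomp x = hcomp y \<longleftrightarrow> (x, y) \<in> H\<^sup>*"
proof
  assume "hcomp x = hcomp y" then show "(x, y) \<in> H\<^sup>*" by (auto simp: hcomp_def)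
next
  assume "(x, y) \<in> H\<^sup>*"
  then show "hcomp x = hcomp y" using hconn_sym by (fastforce simp: hcomp_def intro: rtrancl_trans)
qed

lemma mem_hcomp: "y \<in> hcomp x \<longleftrightarrow> (x, y) \<in> H\<^sup>*"
  by (simp add: hcomp_def)

lemma hcomp_L: "x \<in> L i \<Longrightarrow> hcomp x \<subseteq> L i"
  using hconn_L by (auto simp: hcomp_def)

lemma finite_hcomp: "x \<in> V \<Longrightarrow> finite (hcomp x)"
  using finite_subset[OF hcomp_L L_finite] L_lev by blast

lemma finite_R_image: "finite (R `` {x})"
proof (cases "x \<in> V")
  case True
  then have "R `` {x} \<subseteq> L (Suc (lev x))" using R_L L_lev by blast
  then show ?thesis using L_finite finite_subset by blast
next
  case False
  then have "R `` {x} = {}" using R_P P_levels L_V by blast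
  then show ?thesis by simp
qed

text \<open>
  This makes the components a tree: all parents of all vertices of a component lie in one
  component.
\<close>

lemma parents_hconn:
  assumes "(y, y') \<in> H\<^sup>*" "(x, y) \<in> P" "(x', y') \<in> P"
  shows "(x, x') \<in> H\<^sup>*"
  using assms
proof (induction arbitrary: x' rule: rtrancl_induct)
  case base
  then show ?case using P_H by blast
next
  case (step y' z)
  obtain i where i: "z \<in> L (Suc i)" using step.prems P_levels by blast
  have "y' \<in> L (Suc i)" using H_levels[OF step.hyps(2)] i by (auto simp: L_iff)
  then have p: "(par y', y') \<in> P" using R_par R_P by blast
  with step.IH step.prems P_H[OF p step.prems(2)] step.hyps(2) show ?case
    by (meson rtrancl_trans)
qed

lemma edges_connected_hcomp:
  assumes y: "(x, y) \<in> H\<^sup>*"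
  shows "(x, y) \<in> (H \<inter> hcomp x \<times> hcomp x)\<^sup>*"
  using y
proof (induction rule: rtrancl_induct)
  case (step y z)
  then have "(y, z) \<in> H \<inter> hcomp x \<times> hcomp x" by (auto simp: hcomp_def)
  with step.IH show ?case by (rule rtrancl_into_rtrancl)
qed simp

text \<open>
  A shortest path inside the component needs no more edges than the component has, whence the
  crude bound \<open>M * M\<close>.
\<close>

lemma hcomp_short_path:
  assumes "x \<in> V" "(x, y) \<in> H\<^sup>*" "card (hcomp x) \<le> M"
  shows "\<exists>k\<le>M * M. (x, y) \<in> H ^^ k"
proof -
  let ?H = "H \<inter> hcomp x \<times> hcomp x"
  have fin: "finite (hcomp x \<times> hcomp x)" using finite_hcomp[OF assms(1)] by simp
  then have "finite ?H" by simp
  from rtrancl_finite_eq_relpow[OF this] edges_connected_hcomp[OF assms(2)]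
  obtain k where k: "k \<le> card ?H" "(x, y) \<in> ?H ^^ k" by blast
  have "card ?H \<le> card (hcomp x \<times> hcomp x)" using fin by (intro card_mono) auto
  also have "\<dots> \<le> M * M" using assms(3) by (simp add: card_cartesian_product mult_mono)
  finally have "k \<le> M * M" using k by simp
  moreover have "(x, y) \<in> H ^^ k" using k(2) relpow_mono[of ?H H k] by blast
  ultimately show ?thesis by blast
qed

lemma hconn_equiv: "equiv V (H\<^sup>* \<inter> V \<times> V)"
  by (rule equivI) (auto intro: refl_onI symI transI hconn_sym rtrancl_trans)

lemma par_V: "\<lbrakk>x \<in> V; 0 < lev x\<rbrakk> \<Longrightarrow> par x \<in> V \<and> lev (par x) = lev x - 1"
  using par_L[of x "lev x - 1"] by (simp add: L_iff)

lemma par_R: "\<lbrakk>x \<in> V; 0 < lev x\<rbrakk> \<Longrightarrow> (par x, x) \<in> R"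
  by (simp add: R_iff)

lemma par_hconn: "\<lbrakk>(x, y) \<in> H\<^sup>*; x \<in> V; 0 < lev x\<rbrakk> \<Longrightarrow> (par x, par y) \<in> H\<^sup>*"
  using parents_hconn[of x y] par_R[of x] par_R[of y] hconn_V[of x y] R_P by auto

lemma lev_0: "x \<in> V \<and> lev x = 0 \<longleftrightarrow> x = root"
  using L_iff[of x 0] L_0 by auto

lemma ancestral_full:
  assumes M: "\<And>x. x \<in> V \<Longrightarrow> card (hcomp x) \<le> M"
  shows "ancestral_graph V lev par (H\<^sup>* \<inter> V \<times> V) (P \<union> P\<inverse> \<union> H) (M * M)"
proof
  show "(x, y) \<in> H\<^sup>* \<inter> V \<times> V" if "x \<in> V" "y \<in> V" "lev x = 0" "lev y = 0" for x y
    using that lev_0[of x] lev_0[of y] by auto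
  show "equiv V (H\<^sup>* \<inter> V \<times> V)" by (rule hconn_equiv)
  show "lev x = lev y" if "(x, y) \<in> H\<^sup>* \<inter> V \<times> V" for x y
    using that hconn_V[of x y] by auto
  show "(par x, par y) \<in> H\<^sup>* \<inter> V \<times> V" if "(x, y) \<in> H\<^sup>* \<inter> V \<times> V" "0 < lev x" for x y
    using that par_hconn[of x y] par_V[of x] par_V[of y] hconn_V[of x y] by auto
  show "(x, y) \<in> H\<^sup>* \<inter> V \<times> V \<or> 0 < lev y \<and> y \<in> V \<and> (x, par y) \<in> H\<^sup>* \<inter> V \<times> V \<or>
      0 < lev x \<and> x \<in> V \<and> (par x, y) \<in> H\<^sup>* \<inter> V \<times> V"
    if "(x, y) \<in> P \<union> P\<inverse> \<union> H" for x y
  proof -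
    have child: "0 < lev y \<and> x \<in> V \<and> y \<in> V \<and> par y \<in> V \<and> (x, par y) \<in> H\<^sup>*"
      if p: "(x, y) \<in> P" for x y
    proof -
      obtain i where i: "x \<in> L i" "y \<in> L (Suc i)" using P_levels[OF p] by blast
      then show ?thesis
        using parents_hconn[of y y x "par y"] p R_par[OF i(2)] R_P par_L[OF i(2)]
        by (auto simp: L_iff)
    qed
    from that consider "(x, y) \<in> P" | "(y, x) \<in> P" | "(x, y) \<in> H" by auto
    then show ?thesis
    proof cases
      case 3
      then have "x \<in> V" "y \<in> V" using H_levels[OF 3] L_V by auto
      with 3 show ?thesis by auto
    qed (use child[of x y] child[of y x] hconn_sym[of y "par x"] in auto)
  qed
  show "(x, par x) \<in> P \<union> P\<inverse> \<union> H \<and> (par x, x) \<in> P \<union> P\<inverse> \<union> H" if "x \<in> V" "0 < lev x" for x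
    using par_R[OF that] R_P by blast
  show "\<exists>k\<le>M * M. (x, y) \<in> (P \<union> P\<inverse> \<union> H) ^^ k" if "(x, y) \<in> H\<^sup>* \<inter> V \<times> V" for x y
  proof -
    have "x \<in> V" "(x, y) \<in> H\<^sup>*" using that by simp_all
    from hcomp_short_path[OF this M[OF this(1)]] obtain k where k: "k \<le> M * M" "(x, y) \<in> H ^^ k"
      by (elim exE conjE)
    have "H ^^ k \<subseteq> (P \<union> P\<inverse> \<union> H) ^^ k" by (rule relpow_mono) (rule Un_upper2)
    from subsetD[OF this k(2)] k(1) show ?thesis by (intro exI conjI)
  qed
qed (simp_all add: par_V)

lemma ancestral_tree: "ancestral_graph V lev par (Id_on V) (R \<union> R\<inverse>) 0"
proof
  show "equiv V (Id_on V)"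
    by (rule equivI) (auto intro: refl_onI symI transI)
  show "(x, y) \<in> Id_on V \<or> 0 < lev y \<and> y \<in> V \<and> (x, par y) \<in> Id_on V \<or>
      0 < lev x \<and> x \<in> V \<and> (par x, y) \<in> Id_on V"
    if "(x, y) \<in> R \<union> R\<inverse>" for x y
    using that par_V[of x] par_V[of y] by (auto simp: R_iff)
  show "(x, y) \<in> Id_on V" if "x \<in> V" "y \<in> V" "lev x = 0" "lev y = 0" for x y
    using that lev_0[of x] lev_0[of y] by auto
qed (auto simp: par_V par_R)

text \<open>
  The map \<open>\<pi>\<close> replaces the parent of a vertex by some vertex of the parent component, the
  same one for the whole component, and \<open>\<sigma>\<close> turns \<open>\<pi>\<close> into the parent map of the tree. If the
  images of \<open>x\<close> and \<open>y\<close> have a common ancestor at level \<open>j\<close>, then so do \<open>x\<close> and \<open>y\<close> with respect to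
  \<open>\<pi>\<close>, and their components meet at level \<open>j\<close>. If the components of \<open>x\<close> and \<open>y\<close> meet at level \<open>j\<close>,
  then one more application of \<open>\<pi>\<close> identifies the two ancestors, so the ascents of the images
  have met at level \<open>j - 1\<close>. The loss of one level costs at most two in the distance.
\<close>

theorem rearranged_parents_imp_near_isometry:
  assumes M: "\<And>x. x \<in> V \<Longrightarrow> card (hcomp x) \<le> M"
    and \<sigma>: "bij_betw \<sigma> V V" and lev_\<sigma>: "\<And>x. x \<in> V \<Longrightarrow> lev (\<sigma> x) = lev x"
    and par_\<sigma>: "\<And>y. \<lbrakk>y \<in> V; 0 < lev y\<rbrakk> \<Longrightarrow> par (\<sigma> y) = \<sigma> (\<pi> y)"
    and \<pi>_par: "\<And>y. \<lbrakk>y \<in> V; 0 < lev y\<rbrakk> \<Longrightarrow> (par y, \<pi> y) \<in> H\<^sup>*"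
    and \<pi>_const: "\<And>y y'. \<lbrakk>y \<in> V; 0 < lev y; (y, y') \<in> H\<^sup>*\<rbrakk> \<Longrightarrow> \<pi> y = \<pi> y'"
  shows "near_isometry V (P \<union> P\<inverse> \<union> H) V (R \<union> R\<inverse>) \<sigma>"
proof -
  interpret G: ancestral_graph V lev par "H\<^sup>* \<inter> V \<times> V" "P \<union> P\<inverse> \<union> H" "M * M"
    using ancestral_full M by blast
  interpret T: ancestral_graph V lev par "Id_on V" "R \<union> R\<inverse>" 0
    by (rule ancestral_tree)
  have \<sigma>V: "\<sigma> x \<in> V" if "x \<in> V" for x using \<sigma> that by (auto simp: bij_betw_def)
  have \<pi>V: "\<pi> y \<in> V \<and> lev (\<pi> y) = lev y - 1" if "y \<in> V" "0 < lev y" for y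
    using hconn_V[OF \<pi>_par] par_V that by simp
  have pow: "(\<pi> ^^ i) x \<in> V \<and> lev ((\<pi> ^^ i) x) = lev x - i \<and>
      (par ^^ i) (\<sigma> x) = \<sigma> ((\<pi> ^^ i) x) \<and> ((par ^^ i) x, (\<pi> ^^ i) x) \<in> H\<^sup>*"
    if "x \<in> V" "i \<le> lev x" for i x
    using that(2)
  proof (induction i)
    case 0
    then show ?case using that by simp
  next
    case (Suc i)
    let ?p = "(par ^^ i) x" and ?q = "(\<pi> ^^ i) x"
    have q: "?q \<in> V" "0 < lev ?q" using Suc by auto
    have p: "?p \<in> V" "0 < lev ?p" using G.par_pow[OF that(1), of i] Suc.prems by auto
    have "(par ?p, par ?q) \<in> H\<^sup>*" using par_hconn[of ?p ?q] Suc p by auto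
    then have "(par ?p, \<pi> ?q) \<in> H\<^sup>*" using \<pi>_par[OF q] by (rule rtrancl_trans)
    with Suc q \<pi>V[OF q] par_\<sigma>[OF q] show ?case by auto
  qed
  have same: "T.common j (\<sigma> x) (\<sigma> y) \<longleftrightarrow>
      j \<le> lev x \<and> j \<le> lev y \<and> (\<pi> ^^ (lev x - j)) x = (\<pi> ^^ (lev y - j)) y"
    if "x \<in> V" "y \<in> V" for j x y
  proof -
    have "(par ^^ (lev x - j)) (\<sigma> x) = \<sigma> ((\<pi> ^^ (lev x - j)) x)" "(\<pi> ^^ (lev x - j)) x \<in> V"
      "(par ^^ (lev y - j)) (\<sigma> y) = \<sigma> ((\<pi> ^^ (lev y - j)) y)" "(\<pi> ^^ (lev y - j)) y \<in> V"
      using pow[of x "lev x - j"] pow[of y "lev y - j"] that by simp_all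
    then show ?thesis
      using lev_\<sigma>[OF that(1)] lev_\<sigma>[OF that(2)] \<sigma>V inj_on_eq_iff[OF bij_betw_imp_inj_on[OF \<sigma>]]
      by (simp add: T.common_def Id_on_iff)
  qed
  have down: "G.common j x y" if "T.common j (\<sigma> x) (\<sigma> y)" "x \<in> V" "y \<in> V" for j x y
  proof -
    have *: "j \<le> lev x" "j \<le> lev y" "(\<pi> ^^ (lev x - j)) x = (\<pi> ^^ (lev y - j)) y"
      using same that by auto
    then have "((par ^^ (lev x - j)) x, (par ^^ (lev y - j)) y) \<in> H\<^sup>*"
      using rtrancl_trans[OF _ hconn_sym] pow[of x "lev x - j"] pow[of y "lev y - j"] that(2,3)
      by (metis diff_le_self)
    then show ?thesis using * that G.par_pow by (auto simp: G.common_def)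
  qed
  have up: "T.common (j - 1) (\<sigma> x) (\<sigma> y)" if "G.common j x y" "x \<in> V" "y \<in> V" for j x y
  proof (cases j)
    case 0
    then show ?thesis using T.common_0 \<sigma>V that by simp
  next
    case (Suc i)
    have *: "j \<le> lev x" "j \<le> lev y" "((par ^^ (lev x - j)) x, (par ^^ (lev y - j)) y) \<in> H\<^sup>*"
      using that by (auto simp: G.common_def)
    let ?p = "(\<pi> ^^ (lev x - j)) x" and ?q = "(\<pi> ^^ (lev y - j)) y"
    have p: "?p \<in> V" "0 < lev ?p" using pow[of x "lev x - j"] that * Suc by auto
    have "(?p, ?q) \<in> H\<^sup>*"
    proof -
      have "(?p, (par ^^ (lev x - j)) x) \<in> H\<^sup>*" "((par ^^ (lev y - j)) y, ?q) \<in> H\<^sup>*"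
        using hconn_sym[of _ ?p] pow[of x "lev x - j"] pow[of y "lev y - j"] that by simp_all
      with *(3) show ?thesis by (meson rtrancl_trans)
    qed
    then have "\<pi> ?p = \<pi> ?q" using \<pi>_const p by blast
    moreover have "lev x - i = Suc (lev x - j)" "lev y - i = Suc (lev y - j)"
      using * Suc by auto
    ultimately show ?thesis using same[OF that(2,3), of i] * Suc by auto
  qed
  have "\<bar>real (graph_dist (R \<union> R\<inverse>) (\<sigma> x) (\<sigma> y)) - real (graph_dist (P \<union> P\<inverse> \<union> H) x y)\<bar>
      < real (M * M + 3)" if xy: "x \<in> V" "y \<in> V" for x y
  proof -
    obtain j where j: "G.common j x y" "lev x + lev y \<le> graph_dist (P \<union> P\<inverse> \<union> H) x y + 2 * j"
      using G.graph_dist_lower xy by blast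
    obtain i where i: "T.common i (\<sigma> x) (\<sigma> y)"
      "lev (\<sigma> x) + lev (\<sigma> y) \<le> graph_dist (R \<union> R\<inverse>) (\<sigma> x) (\<sigma> y) + 2 * i"
      using T.graph_dist_lower \<sigma>V xy by blast
    have 1: "graph_dist (R \<union> R\<inverse>) (\<sigma> x) (\<sigma> y) + 2 * (j - 1) \<le> lev x + lev y"
      using T.graph_dist_upper[OF up[OF j(1) xy] \<sigma>V \<sigma>V] xy lev_\<sigma> by auto
    have 2: "graph_dist (P \<union> P\<inverse> \<union> H) x y + 2 * i \<le> lev x + lev y + M * M"
      using G.graph_dist_upper[OF down[OF i(1) xy] xy] .
    have "graph_dist (R \<union> R\<inverse>) (\<sigma> x) (\<sigma> y) \<le> graph_dist (P \<union> P\<inverse> \<union> H) x y + 2"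
      using 1 j(2) by linarith
    moreover have "graph_dist (P \<union> P\<inverse> \<union> H) x y \<le> graph_dist (R \<union> R\<inverse>) (\<sigma> x) (\<sigma> y) + M * M"
      using 2 i(2) lev_\<sigma> xy by auto
    ultimately show ?thesis by linarith
  qed
  moreover have "0 < real (M * M + 3)" unfolding of_nat_0_less_iff by simp
  ultimately show ?thesis unfolding near_isometry_def using \<sigma> by blast
qed

text \<open>
  Level by level: a vertex \<open>y\<close> is sent to an offspring of \<open>\<sigma> (\<pi> y)\<close> with the same type. By
  \<open>counts\<close> the vertices \<open>y\<close> of type \<open>k\<close> with \<open>\<pi> y = x\<close> are as many as the tree offspring of \<open>x\<close> of
  type \<open>k\<close>; by \<open>ty_R\<close> this is also the number for \<open>\<sigma> x\<close>, since \<open>\<sigma> x\<close> has the type of \<open>x\<close>.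
\<close>

lemma exists_level_bijection:
  fixes ty :: "'v \<Rightarrow> 'k"
  assumes \<pi>_L: "\<And>i y. y \<in> L (Suc i) \<Longrightarrow> \<pi> y \<in> L i"
    and counts: "\<And>x k. x \<in> V \<Longrightarrow>
      card {y \<in> L (Suc (lev x)). \<pi> y = x \<and> ty y = k} = card {y. (x, y) \<in> R \<and> ty y = k}"
    and ty_R: "\<And>x x' k. \<lbrakk>x \<in> V; x' \<in> V; ty x = ty x'\<rbrakk> \<Longrightarrow>
      card {y. (x, y) \<in> R \<and> ty y = k} = card {y. (x', y) \<in> R \<and> ty y = k}"
  shows "\<exists>\<sigma>. bij_betw \<sigma> V V \<and> (\<forall>x\<in>V. lev (\<sigma> x) = lev x) \<and>
    (\<forall>y\<in>V. 0 < lev y \<longrightarrow> par (\<sigma> y) = \<sigma> (\<pi> y))"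
proof -
  let ?P = "\<lambda>i g. bij_betw g (L i) (L i) \<and> (\<forall>x\<in>L i. ty (g x) = ty x)"
  let ?Q = "\<lambda>i g g'. \<forall>y\<in>L (Suc i). par (g' y) = g (\<pi> y)"
  have step: "\<exists>g'. ?P (Suc i) g' \<and> ?Q i g g'" if g: "?P i g" for i g
  proof -
    have g_in: "g x \<in> L i \<and> ty (g x) = ty x" if "x \<in> L i" for x
      using g that by (auto simp: bij_betw_def)
    have "\<exists>h. bij_betw h (L (Suc i)) (L (Suc i)) \<and>
        (\<forall>y\<in>L (Suc i). (par (h y), ty (h y)) = (g (\<pi> y), ty y))"
    \<comment> \<open>Prescribe the parent and the type of the image.\<close>
    proof (rule bij_betw_matching_fibres)
      fix q :: "'v \<times> 'k"
      obtain z k where q: "q = (z, k)" by force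
      show "card {y \<in> L (Suc i). (g (\<pi> y), ty y) = q} = card {y \<in> L (Suc i). (par y, ty y) = q}"
      proof (cases "z \<in> L i")
        case True
        then obtain x where x: "x \<in> L i" "z = g x" using g by (auto simp: bij_betw_def)
        have "{y \<in> L (Suc i). (g (\<pi> y), ty y) = q} = {y \<in> L (Suc (lev x)). \<pi> y = x \<and> ty y = k}"
          using x q \<pi>_L g lev_eq[OF x(1)] by (auto simp: bij_betw_def inj_on_eq_iff)
        moreover have "{y \<in> L (Suc i). (par y, ty y) = q} = {y. (g x, y) \<in> R \<and> ty y = k}"
          using x q True R_L[of "g x" _ i] by (auto simp: R_iff L_iff)
        ultimately show ?thesis using counts[of x k] ty_R[of x "g x" k] x g_in[OF x(1)] L_V by auto
      next
        case False
        then have "{y \<in> L (Suc i). (g (\<pi> y), ty y) = q} = {}"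
          "{y \<in> L (Suc i). (par y, ty y) = q} = {}"
          using q g_in \<pi>_L par_L by auto
        then show ?thesis by (simp only:)
      qed
    qed (rule L_finite)+
    then show ?thesis by auto
  qed
  have "?P 0 id" by simp
  then obtain g where g: "\<And>i. ?P i (g i)" and Q: "\<And>i. ?Q i (g i) (g (Suc i))"
    using dependent_nat_choice[of ?P ?Q] step by blast
  define \<sigma> where "\<sigma> = (\<lambda>x. g (lev x) x)"
  have \<sigma>_L: "\<sigma> x = g i x" if "x \<in> L i" for x i using lev_eq[OF that] by (simp add: \<sigma>_def)
  have g_L: "g i x \<in> L i" if "x \<in> L i" for x i using g[of i] that by (auto simp: bij_betw_def)
  have lev_\<sigma>: "\<sigma> x \<in> L (lev x)" if "x \<in> V" for x using g_L L_lev that by (simp add: \<sigma>_def)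
  have "bij_betw \<sigma> V V"
    unfolding bij_betw_def
  proof (intro conjI inj_onI equalityI subsetI)
    fix x y assume xy: "x \<in> V" "y \<in> V" "\<sigma> x = \<sigma> y"
    then have "lev x = lev y" using lev_\<sigma> L_unique by metis
    with xy L_lev[of x] L_lev[of y] show "x = y"
      using inj_onD[OF bij_betw_imp_inj_on[of "g (lev x)"], of "L (lev x)" "L (lev x)" x y] g[of "lev x"]
      by (simp add: \<sigma>_def)
  next
    fix y assume "y \<in> \<sigma> ` V" then show "y \<in> V" using lev_\<sigma> L_V by blast
  next
    fix y assume "y \<in> V"
    then have "y \<in> g (lev y) ` L (lev y)" using g[of "lev y"] L_lev by (auto simp: bij_betw_def)
    then show "y \<in> \<sigma> ` V" using \<sigma>_L L_V by fastforce
  qed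
  moreover have "par (\<sigma> y) = \<sigma> (\<pi> y)" if "y \<in> V" "0 < lev y" for y
  proof -
    have y: "y \<in> L (Suc (lev y - 1))" using that by (simp add: L_iff)
    show ?thesis using Q[of "lev y - 1"] y \<sigma>_L[OF y] \<sigma>_L[OF \<pi>_L[OF y]] by simp
  qed
  ultimately show ?thesis using lev_\<sigma> lev_eq by blast
qed

end


section \<open>Rearrangeable incidence matrices\<close>

text \<open>
  Types \<open>ty\<close> of vertices stand for the classes of the reduced tree and \<open>ct\<close> for the classes of
  components, both as indices of rows and columns. The isomorphisms that define the
  classes enter through two facts: the matrices \<open>A\<close>, \<open>B\<close>, \<open>u\<close> count correctly for every
  representative, and the row of \<open>B\<close> determines the type.
\<close>

locale rearrangeable_graph = layered_graph L P H R root
  for L :: "nat \<Rightarrow> 'v set" and P H R :: "('v \<times> 'v) set" and root :: 'v +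
  fixes m n :: nat and A B u :: "nat \<Rightarrow> nat \<Rightarrow> nat"
    and ty :: "'v \<Rightarrow> nat" and ct :: "'v set \<Rightarrow> nat"
  assumes ty: "x \<in> V \<Longrightarrow> ty x \<in> {1..n}"
    and ct: "x \<in> V \<Longrightarrow> ct (hcomp x) \<in> {1..m}"
    and A: "\<lbrakk>x \<in> V; l \<in> {1..m}\<rbrakk> \<Longrightarrow>
      A (ct (hcomp x)) l = card {Z \<in> hcomp ` V. Z \<subseteq> P `` hcomp x \<and> ct Z = l}"
    and B: "\<lbrakk>x \<in> V; k \<in> {1..n}\<rbrakk> \<Longrightarrow> B (ty x) k = card {y. (x, y) \<in> R \<and> ty y = k}"
    and u: "\<lbrakk>x \<in> V; k \<in> {1..n}\<rbrakk> \<Longrightarrow> u (ct (hcomp x)) k = card {y \<in> hcomp x. ty y = k}"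
    and B_rows: "\<lbrakk>x \<in> V; y \<in> V; \<forall>k\<in>{1..n}. B (ty x) k = B (ty y) k\<rbrakk> \<Longrightarrow> ty x = ty y"
    and ty_surj: "j \<in> {1..n} \<Longrightarrow> \<exists>x\<in>V. ty x = j"
    and rearrangeable: "rearrangeable m n B u A"
begin

lemma card_hcomp: assumes "x \<in> V" shows "card (hcomp x) = (\<Sum>j = 1..n. u (ct (hcomp x)) j)"
proof -
  have "hcomp x \<subseteq> V" using hconn_V assms by (auto simp: hcomp_def)
  then have "hcomp x = (\<Union>j\<in>{1..n}. {y \<in> hcomp x. ty y = j})" using ty by auto
  then have "card (hcomp x) = card (\<Union>j\<in>{1..n}. {y \<in> hcomp x. ty y = j})" by simp
  also have "\<dots> = (\<Sum>j = 1..n. card {y \<in> hcomp x. ty y = j})"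
    using finite_hcomp[OF assms] by (intro card_UN_disjoint) auto
  also have "\<dots> = (\<Sum>j = 1..n. u (ct (hcomp x)) j)" using u[OF assms] by (intro sum.cong) auto
  finally show ?thesis .
qed

lemma card_hcomp_bounded: "\<exists>M. \<forall>x\<in>V. card (hcomp x) \<le> M"
proof (intro exI ballI)
  fix x assume x: "x \<in> V"
  show "card (hcomp x) \<le> (\<Sum>i = 1..m. \<Sum>j = 1..n. u i j)"
    unfolding card_hcomp[OF x] using ct[OF x] by (intro member_le_sum) auto
qed

lemma offspring_hcomp:
  assumes "y \<in> P `` hcomp x" shows "hcomp y \<subseteq> P `` hcomp x"
proof
  fix z assume z: "z \<in> hcomp y"
  obtain x' where x': "x' \<in> hcomp x" "(x', y) \<in> P" using assms by blast
  obtain i where i: "x' \<in> L i" "y \<in> L (Suc i)" using P_levels[OF x'(2)] by blast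
  have yz: "(y, z) \<in> H\<^sup>*" using z by (simp add: mem_hcomp)
  then have "z \<in> L (Suc i)" using hconn_L i by blast
  then have p: "(par z, z) \<in> P" using R_par R_P by blast
  have "(x', par z) \<in> H\<^sup>*" using parents_hconn[OF yz x'(2) p] .
  then have "par z \<in> hcomp x" using x'(1) unfolding mem_hcomp by (meson rtrancl_trans)
  with p show "z \<in> P `` hcomp x" by blast
qed

lemma offspring_par: "y \<in> P `` hcomp x \<longleftrightarrow> y \<in> V \<and> 0 < lev y \<and> par y \<in> hcomp x"
proof
  assume "y \<in> P `` hcomp x"
  then obtain x' where x': "x' \<in> hcomp x" "(x', y) \<in> P" by blast
  obtain i where i: "x' \<in> L i" "y \<in> L (Suc i)" using P_levels[OF x'(2)] by blast
  have "(x', par y) \<in> H\<^sup>*" using parents_hconn[of y y x' "par y"] x' R_par[OF i(2)] R_P by blast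
  then show "y \<in> V \<and> 0 < lev y \<and> par y \<in> hcomp x"
    using i x'(1) unfolding mem_hcomp by (auto simp: L_iff)
next
  assume "y \<in> V \<and> 0 < lev y \<and> par y \<in> hcomp x"
  then show "y \<in> P `` hcomp x" using par_R R_P by blast
qed

text \<open>
  The sets of rows of \<open>C\<close> that reproduce the various rows of \<open>B\<close> are disjoint, because the rows
  of \<open>B\<close> differ, and their sizes add up to the number of all rows; so each row of \<open>C\<close> reproduces
  the row of \<open>B\<close> of exactly one type, and the rows can be indexed by the vertices of the component
  so that these types match.
\<close>

lemma labelled_rows:
  assumes i: "x \<in> V"
  shows "\<exists>e C. bij_betw e (hcomp x) {1..card (hcomp x)} \<and>
    (\<forall>l\<in>{1..m}. A (ct (hcomp x)) l = (\<Sum>s = 1..card (hcomp x). C s l)) \<and>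
    (\<forall>z\<in>hcomp x. \<forall>k\<in>{1..n}. (\<Sum>l = 1..m. C (e z) l * u l k) = B (ty z) k)"
proof -
  let ?i = "ct (hcomp x)" and ?p = "card (hcomp x)"
  obtain C where C: "\<And>l. l \<in> {1..m} \<Longrightarrow> A ?i l = (\<Sum>s = 1..?p. C s l)"
    and rows: "\<And>j. j \<in> {1..n} \<Longrightarrow>
      card {s \<in> {1..?p}. \<forall>k\<in>{1..n}. (\<Sum>l = 1..m. C s l * u l k) = B j k} = u ?i j"
    using rearrangeable ct[OF i] unfolding rearrangeable_def Let_def card_hcomp[OF i] by blast
  define Sj where "Sj = (\<lambda>j. {s \<in> {1..?p}. \<forall>k\<in>{1..n}. (\<Sum>l = 1..m. C s l * u l k) = B j k})"
  have disj: "Sj j \<inter> Sj j' = {}" if jj': "j \<in> {1..n}" "j' \<in> {1..n}" "j \<noteq> j'" for j j'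
  proof -
    obtain y y' where y: "y \<in> V" "ty y = j" "y' \<in> V" "ty y' = j'"
      using ty_surj[OF jj'(1)] ty_surj[OF jj'(2)] by blast
    show ?thesis
    proof (rule ccontr)
      assume "\<not> ?thesis"
      then obtain s where "s \<in> Sj j" "s \<in> Sj j'" by blast
      then have "\<forall>k\<in>{1..n}. B j k = B j' k" unfolding Sj_def by auto
      then show False using B_rows[of y y'] y jj' by simp
    qed
  qed
  have "card (\<Union>j\<in>{1..n}. Sj j) = (\<Sum>j = 1..n. card (Sj j))"
    using disj by (intro card_UN_disjoint) (auto simp: Sj_def)
  also have "\<dots> = ?p" unfolding card_hcomp[OF i] using rows
    by (intro sum.cong) (auto simp: Sj_def card_hcomp[OF i])
  finally have "(\<Union>j\<in>{1..n}. Sj j) = {1..?p}"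
    by (intro card_subset_eq) (auto simp: Sj_def)
  then have "\<forall>s\<in>{1..?p}. \<exists>j. j \<in> {1..n} \<and> s \<in> Sj j" by blast
  then obtain g where g: "\<And>s. s \<in> {1..?p} \<Longrightarrow> g s \<in> {1..n} \<and> s \<in> Sj (g s)" by metis
  have g_eq: "g s = j \<longleftrightarrow> s \<in> Sj j" if "s \<in> {1..?p}" "j \<in> {1..n}" for s j
    using g[OF that(1)] disj[of "g s" j] that by blast
  have "\<exists>e. bij_betw e (hcomp x) {1..?p} \<and> (\<forall>z\<in>hcomp x. g (e z) = ty z)"
  proof (rule bij_betw_matching_fibres)
    show "finite (hcomp x)" by (rule finite_hcomp[OF i])
    show "card {z \<in> hcomp x. ty z = j} = card {s \<in> {1..?p}. g s = j}" for j
    proof (cases "j \<in> {1..n}")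
      case True
      then have "{s \<in> {1..?p}. g s = j} = Sj j" using g_eq by (auto simp: Sj_def)
      then show ?thesis using rows[OF True] u[OF i True] by (simp add: Sj_def)
    next
      case False
      have "{z \<in> hcomp x. ty z = j} = {}" using False ty hconn_V i by (auto simp: mem_hcomp)
      moreover have "{s \<in> {1..?p}. g s = j} = {}" using False g by blast
      ultimately show ?thesis by (simp only: card.empty)
    qed
  qed simp
  then obtain e where e: "bij_betw e (hcomp x) {1..?p}" "\<And>z. z \<in> hcomp x \<Longrightarrow> g (e z) = ty z"
    by blast
  have "(\<Sum>l = 1..m. C (e z) l * u l k) = B (ty z) k" if "z \<in> hcomp x" "k \<in> {1..n}" for z k
    using g[of "e z"] e(2)[OF that(1)] bij_betwE[OF e(1)] that by (auto simp: Sj_def)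
  with e(1) C show ?thesis by blast
qed

text \<open>
  The components of the offspring are distributed among the rows of \<open>C\<close> so that the row \<open>s\<close>
  receives \<open>C s l\<close> components of class \<open>l\<close>, which is possible because the rows of \<open>C\<close> add up to the
  row of \<open>A\<close>. The map \<open>\<pi>\<close> sends a vertex to the one that labels the row of its component; the
  vertices sent to \<open>z\<close> then have the type distribution \<open>\<Sum>\<^sub>l C s l * u l k\<close>, which is
  the row of \<open>B\<close> for the type of \<open>z\<close>.
\<close>

lemma rearranged_offspring:
  assumes x: "x \<in> V"
  shows "\<exists>\<pi>. (\<forall>y\<in>P `` hcomp x. \<pi> y \<in> hcomp x) \<and>
    (\<forall>y\<in>P `` hcomp x. \<forall>y'. (y, y') \<in> H\<^sup>* \<longrightarrow> \<pi> y = \<pi> y') \<and>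
    (\<forall>z\<in>hcomp x. \<forall>k. card {y \<in> P `` hcomp x. \<pi> y = z \<and> ty y = k} = card {y. (z, y) \<in> R \<and> ty y = k})"
proof -
  let ?T = "hcomp x" and ?p = "card (hcomp x)"
  define Zs where "Zs = {Z \<in> hcomp ` V. Z \<subseteq> P `` ?T}"
  have TV: "z \<in> V" if "z \<in> ?T" for z using that hconn_V[OF _ x] by (auto simp: mem_hcomp)
  obtain e C where e: "bij_betw e ?T {1..?p}"
    and C: "\<And>l. l \<in> {1..m} \<Longrightarrow> A (ct ?T) l = (\<Sum>s = 1..?p. C s l)"
    and rows: "\<And>z k. z \<in> ?T \<Longrightarrow> k \<in> {1..n} \<Longrightarrow> (\<Sum>l = 1..m. C (e z) l * u l k) = B (ty z) k"
    using labelled_rows[OF x] by blast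
  have PT: "P `` ?T \<subseteq> L (Suc (lev x))" using hcomp_L[OF L_lev[OF x]] P_L by blast
  have PTV: "y \<in> V" if "y \<in> P `` ?T" for y using that PT L_V by blast
  have fin: "finite (P `` ?T)" using finite_subset[OF PT L_finite] .
  have finZ: "finite Zs" by (rule finite_subset[of _ "Pow (P `` ?T)"]) (use fin in \<open>auto simp: Zs_def\<close>)
  have compZ: "hcomp y \<in> Zs" if "y \<in> P `` ?T" for y
    using offspring_hcomp[OF that] PTV[OF that] by (auto simp: Zs_def)
  have ctZ: "ct Z \<in> {1..m}" if "Z \<in> Zs" for Z using that ct by (auto simp: Zs_def)
  \<comment> \<open>One slot \<open>(s, l, i)\<close> for each of the \<open>C s l\<close> components of class \<open>l\<close> owed to the row \<open>s\<close>.\<close>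
  let ?I = "Sigma {1..?p} (\<lambda>s. Sigma {1..m} (\<lambda>l. {..<C s l}))"
  have slots: "{b \<in> ?I. fst b = s \<and> fst (snd b) = l} = {s} \<times> {l} \<times> {..<C s l}"
    if "s \<in> {1..?p}" "l \<in> {1..m}" for s l
    using that by auto
  have "\<exists>h. bij_betw h Zs ?I \<and> (\<forall>Z\<in>Zs. fst (snd (h Z)) = ct Z)"
  proof (rule bij_betw_matching_fibres)
    show "card {Z \<in> Zs. ct Z = l} = card {b \<in> ?I. fst (snd b) = l}" for l
    proof (cases "l \<in> {1..m}")
      case True
      have "{b \<in> ?I. fst (snd b) = l} = (SIGMA s:{1..?p}. {l} \<times> {..<C s l})" using True by auto
      then have "card {b \<in> ?I. fst (snd b) = l} = (\<Sum>s = 1..?p. C s l)" by simp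
      moreover have "{Z \<in> Zs. ct Z = l} = {Z \<in> hcomp ` V. Z \<subseteq> P `` hcomp x \<and> ct Z = l}"
        by (auto simp: Zs_def)
      ultimately show ?thesis using A[OF x True] C[OF True] by simp
    next
      case False
      then have "{Z \<in> Zs. ct Z = l} = {}" "{b \<in> ?I. fst (snd b) = l} = {}" using ctZ by auto
      then show ?thesis by (simp only: card.empty)
    qed
  qed (use finZ in auto)
  then obtain h where h: "bij_betw h Zs ?I" and h_ct: "\<And>Z. Z \<in> Zs \<Longrightarrow> fst (snd (h Z)) = ct Z"
    by blast
  have h_in: "fst (h Z) \<in> {1..?p}" if "Z \<in> Zs" for Z using bij_betwE[OF h] that by fastforce
  have card_slot: "card {Z \<in> Zs. fst (h Z) = s \<and> ct Z = l} = C s l"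
    if "s \<in> {1..?p}" "l \<in> {1..m}" for s l
  proof -
    have "bij_betw h {Z \<in> Zs. fst (h Z) = s \<and> ct Z = l} {b \<in> ?I. fst b = s \<and> fst (snd b) = l}"
    proof (rule bij_betw_subset[OF h])
      show "h ` {Z \<in> Zs. fst (h Z) = s \<and> ct Z = l} = {b \<in> ?I. fst b = s \<and> fst (snd b) = l}"
      proof (intro equalityI subsetI)
        fix b assume "b \<in> h ` {Z \<in> Zs. fst (h Z) = s \<and> ct Z = l}"
        then obtain Z where Z: "Z \<in> Zs" "fst (h Z) = s" "ct Z = l" "b = h Z" by blast
        have "h Z \<in> ?I" using h Z(1) by (rule bij_betw_apply)
        then show "b \<in> {b \<in> ?I. fst b = s \<and> fst (snd b) = l}"
          unfolding mem_Collect_eq using Z h_ct[OF Z(1)] by (intro conjI) simp_all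
      next
        fix b assume "b \<in> {b \<in> ?I. fst b = s \<and> fst (snd b) = l}"
        then have b: "b \<in> ?I" "fst b = s" "fst (snd b) = l" unfolding mem_Collect_eq by blast+
        then have "b \<in> h ` Zs" using bij_betw_imp_surj_on[OF h] by simp
        then obtain Z where Z: "b = h Z" "Z \<in> Zs" by (rule imageE)
        then have "Z \<in> {Z \<in> Zs. fst (h Z) = s \<and> ct Z = l}" using b h_ct[OF Z(2)] by simp
        then show "b \<in> h ` {Z \<in> Zs. fst (h Z) = s \<and> ct Z = l}" unfolding Z(1) by (rule imageI)
      qed
    qed auto
    then have "card {Z \<in> Zs. fst (h Z) = s \<and> ct Z = l} = card ({s} \<times> {l} \<times> {..<C s l})"
      unfolding slots[OF that] by (rule bij_betw_same_card)
    then show ?thesis by simp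
  qed
  define \<pi> where "\<pi> = (\<lambda>y. inv_into ?T e (fst (h (hcomp y))))"
  have \<pi>_iff: "\<pi> y = z \<longleftrightarrow> fst (h (hcomp y)) = e z" if "y \<in> P `` ?T" "z \<in> ?T" for y z
  proof -
    have "fst (h (hcomp y)) \<in> e ` ?T" using h_in[OF compZ[OF that(1)]] e by (simp add: bij_betw_def)
    then show ?thesis unfolding \<pi>_def
      using f_inv_into_f[of "fst (h (hcomp y))" e ?T] bij_betw_inv_into_left[OF e that(2)] by auto
  qed
  have "\<pi> y \<in> ?T" if "y \<in> P `` ?T" for y
    unfolding \<pi>_def using h_in[OF compZ[OF that]] e by (auto simp: bij_betw_def intro!: inv_into_into)
  moreover have "\<pi> y = \<pi> y'" if "(y, y') \<in> H\<^sup>*" for y y'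
    using that hcomp_eq_iff[of y y'] by (simp add: \<pi>_def)
  moreover have "card {y \<in> P `` ?T. \<pi> y = z \<and> ty y = k} = card {y. (z, y) \<in> R \<and> ty y = k}"
    if z: "z \<in> ?T" for z k
  proof (cases "k \<in> {1..n}")
    case False
    have "{y \<in> P `` ?T. \<pi> y = z \<and> ty y = k} = {}" using False PTV ty by blast
    moreover have "{y. (z, y) \<in> R \<and> ty y = k} = {}" using False ty by (auto simp: R_iff)
    ultimately show ?thesis by (simp only: card.empty)
  next
    case k: True
    let ?Z = "\<lambda>l. {Z \<in> Zs. fst (h Z) = e z \<and> ct Z = l}"
    have ez: "e z \<in> {1..?p}" using bij_betwE[OF e] z by blast
    have Z_k: "card {y \<in> Z. ty y = k} = u (ct Z) k" if "Z \<in> Zs" for Z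
      using that u[OF _ k] by (auto simp: Zs_def)
    have Z_fin: "finite Z" if "Z \<in> Zs" for Z using that finite_hcomp by (auto simp: Zs_def)
    have "{y \<in> P `` ?T. \<pi> y = z \<and> ty y = k} = (\<Union>Z\<in>(\<Union>l\<in>{1..m}. ?Z l). {y \<in> Z. ty y = k})"
    proof (intro equalityI subsetI)
      fix y assume y: "y \<in> {y \<in> P `` ?T. \<pi> y = z \<and> ty y = k}"
      then have "hcomp y \<in> Zs" "fst (h (hcomp y)) = e z" using compZ \<pi>_iff z by auto
      moreover have "y \<in> hcomp y" by (simp add: mem_hcomp)
      ultimately show "y \<in> (\<Union>Z\<in>(\<Union>l\<in>{1..m}. ?Z l). {y \<in> Z. ty y = k})"
        using y ctZ by blast
    next
      fix y assume "y \<in> (\<Union>Z\<in>(\<Union>l\<in>{1..m}. ?Z l). {y \<in> Z. ty y = k})"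
      then obtain Z where Z: "Z \<in> Zs" "fst (h Z) = e z" "y \<in> Z" "ty y = k" by blast
      then obtain w where w: "Z = hcomp w" "w \<in> V" "Z \<subseteq> P `` ?T" by (auto simp: Zs_def)
      then have "hcomp y = Z" using Z(3) hcomp_eq_iff[of w y] by (auto simp: mem_hcomp)
      moreover have "y \<in> P `` ?T" using w(3) Z(3) by blast
      ultimately show "y \<in> {y \<in> P `` ?T. \<pi> y = z \<and> ty y = k}"
        using Z(2,4) \<pi>_iff[of y z] z by simp
    qed
    also have "card \<dots> = (\<Sum>Z\<in>(\<Union>l\<in>{1..m}. ?Z l). card {y \<in> Z. ty y = k})"
    proof (rule card_UN_disjoint)
      show "\<forall>Z\<in>(\<Union>l\<in>{1..m}. ?Z l). \<forall>Z'\<in>(\<Union>l\<in>{1..m}. ?Z l). Z \<noteq> Z' \<longrightarrow>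
          {y \<in> Z. ty y = k} \<inter> {y \<in> Z'. ty y = k} = {}"
      proof (intro ballI impI)
        fix Z Z' assume "Z \<in> (\<Union>l\<in>{1..m}. ?Z l)" "Z' \<in> (\<Union>l\<in>{1..m}. ?Z l)" "Z \<noteq> Z'"
        then obtain w w' where w: "Z = hcomp w" "Z' = hcomp w'" "hcomp w \<noteq> hcomp w'"
          by (auto simp: Zs_def)
        have "False" if "y \<in> Z" "y \<in> Z'" for y
          using that w hcomp_eq_iff[of w y] hcomp_eq_iff[of w' y] by (simp add: mem_hcomp)
        then show "{y \<in> Z. ty y = k} \<inter> {y \<in> Z'. ty y = k} = {}" by blast
      qed
    qed (use finZ Z_fin in auto)
    also have "\<dots> = (\<Sum>l = 1..m. \<Sum>Z\<in>?Z l. card {y \<in> Z. ty y = k})"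
      using finZ by (intro sum.UNION_disjoint) auto
    also have "\<dots> = (\<Sum>l = 1..m. \<Sum>Z\<in>?Z l. u l k)"
      using Z_k by (intro sum.cong) auto
    also have "\<dots> = (\<Sum>l = 1..m. C (e z) l * u l k)"
      using card_slot[OF ez] by (intro sum.cong) auto
    also have "\<dots> = card {y. (z, y) \<in> R \<and> ty y = k}"
      using rows[OF z k] B[OF TV[OF z] k] by simp
    finally show ?thesis .
  qed
  ultimately show ?thesis by blast
qed

text \<open>
  The local maps of \<open>rearranged_offspring\<close>, one for each component, combine into a single map
  because every vertex other than the root is offspring of exactly one component.
\<close>

theorem exists_near_isometry:
  "\<exists>\<sigma>. near_isometry V (P \<union> P\<inverse> \<union> H) V (R \<union> R\<inverse>) \<sigma> \<and> \<sigma> root = root"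
proof -
  define good where "good = (\<lambda>T \<pi>. (\<forall>y\<in>P `` T. \<pi> y \<in> T) \<and>
    (\<forall>y\<in>P `` T. \<forall>y'. (y, y') \<in> H\<^sup>* \<longrightarrow> \<pi> y = \<pi> y') \<and>
    (\<forall>z\<in>T. \<forall>k. card {y \<in> P `` T. \<pi> y = z \<and> ty y = k} = card {y. (z, y) \<in> R \<and> ty y = k}))"
  have "\<forall>T\<in>hcomp ` V. \<exists>\<pi>. good T \<pi>"
    unfolding good_def using rearranged_offspring by simp
  then obtain \<rho> where "\<forall>T\<in>hcomp ` V. good T (\<rho> T)" by (rule bchoice[THEN exE])
  then have \<rho>: "good (hcomp x) (\<rho> (hcomp x))" if "x \<in> V" for x using that by simp
  define \<pi> where "\<pi> = (\<lambda>y. \<rho> (hcomp (par y)) y)"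
  have mem: "par y \<in> V" "y \<in> P `` hcomp (par y)" if "y \<in> V" "0 < lev y" for y
    using offspring_par[of y "par y"] par_V[OF that] that by (auto simp: mem_hcomp)
  have \<pi>_par: "(par y, \<pi> y) \<in> H\<^sup>*" if "y \<in> V" "0 < lev y" for y
    using \<rho>[OF mem(1)[OF that]] mem(2)[OF that] unfolding \<pi>_def good_def mem_hcomp[symmetric] by blast
  have \<pi>_const: "\<pi> y = \<pi> y'" if "y \<in> V" "0 < lev y" "(y, y') \<in> H\<^sup>*" for y y'
  proof -
    have "hcomp (par y') = hcomp (par y)"
      using hcomp_eq_iff[of "par y" "par y'"] par_hconn[OF that(3,1,2)] by simp
    then show ?thesis
      using \<rho>[OF mem(1)[OF that(1,2)]] mem(2)[OF that(1,2)] that(3)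
      unfolding \<pi>_def good_def by simp
  qed
  have \<pi>_L: "\<pi> y \<in> L i" if "y \<in> L (Suc i)" for i y
    using \<pi>_par[of y] that hconn_L[OF _ par_L[OF that]] by (auto simp: L_iff)
  have counts: "card {y \<in> L (Suc (lev x)). \<pi> y = x \<and> ty y = k} = card {y. (x, y) \<in> R \<and> ty y = k}"
    if x: "x \<in> V" for x k
  proof -
    have "y \<in> L (Suc (lev x)) \<and> \<pi> y = x \<longleftrightarrow> y \<in> P `` hcomp x \<and> \<rho> (hcomp x) y = x" for y
    proof
      assume y: "y \<in> L (Suc (lev x)) \<and> \<pi> y = x"
      then have "(par y, x) \<in> H\<^sup>*" using \<pi>_par[of y] by (auto simp: L_iff)
      then have "hcomp (par y) = hcomp x" by (simp add: hcomp_eq_iff)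
      then show "y \<in> P `` hcomp x \<and> \<rho> (hcomp x) y = x"
        using y mem[of y] by (auto simp: \<pi>_def L_iff)
    next
      assume y: "y \<in> P `` hcomp x \<and> \<rho> (hcomp x) y = x"
      then have *: "y \<in> V" "0 < lev y" "(x, par y) \<in> H\<^sup>*"
        using offspring_par by (auto simp: mem_hcomp)
      then have "hcomp (par y) = hcomp x" using hcomp_eq_iff[of x "par y"] by simp
      with y have "\<pi> y = x" by (simp add: \<pi>_def)
      moreover have "lev y = Suc (lev x)" using * hconn_V[OF *(3) x] par_V[of y] by auto
      ultimately show "y \<in> L (Suc (lev x)) \<and> \<pi> y = x" using * by (simp add: L_iff)
    qed
    then have "{y \<in> L (Suc (lev x)). \<pi> y = x \<and> ty y = k} = {y \<in> P `` hcomp x. \<rho> (hcomp x) y = x \<and> ty y = k}"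
      by blast
    then show ?thesis using \<rho>[OF x] unfolding good_def by (simp add: mem_hcomp)
  qed
  have ty_R: "card {y. (x, y) \<in> R \<and> ty y = k} = card {y. (x', y) \<in> R \<and> ty y = k}"
    if "x \<in> V" "x' \<in> V" "ty x = ty x'" for x x' k
  proof (cases "k \<in> {1..n}")
    case True
    then show ?thesis using B[OF that(1) True] B[OF that(2) True] that(3) by simp
  next
    case False
    then have "{y. (x, y) \<in> R \<and> ty y = k} = {}" "{y. (x', y) \<in> R \<and> ty y = k} = {}"
      using ty by (auto simp: R_iff)
    then show ?thesis by (simp only: card.empty)
  qed
  obtain \<sigma> where \<sigma>: "bij_betw \<sigma> V V" "\<And>x. x \<in> V \<Longrightarrow> lev (\<sigma> x) = lev x"
    "\<And>y. y \<in> V \<Longrightarrow> 0 < lev y \<Longrightarrow> par (\<sigma> y) = \<sigma> (\<pi> y)"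
    using exists_level_bijection[of \<pi> ty] \<pi>_L counts ty_R by blast
  obtain M where M: "\<And>x. x \<in> V \<Longrightarrow> card (hcomp x) \<le> M" using card_hcomp_bounded by blast
  have "near_isometry V (P \<union> P\<inverse> \<union> H) V (R \<union> R\<inverse>) \<sigma>"
    by (rule rearranged_parents_imp_near_isometry[OF M \<sigma> \<pi>_par \<pi>_const])
  moreover have "\<sigma> root = root"
  proof -
    have r: "root \<in> V" "lev root = 0" using lev_0[of root] by auto
    then have "\<sigma> root \<in> V" using \<sigma>(1) by (auto simp: bij_betw_def)
    then show ?thesis using lev_0[of "\<sigma> root"] \<sigma>(2)[OF r(1)] r by auto
  qed
  ultimately show ?thesis by blast
qed

end


section \<open>Trees are determined by their counts of offspring\<close>

context layered_graph
begin

lemma descendant_ancestor: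
  assumes "(z, w) \<in> R\<^sup>*" "z \<in> V"
  shows "w \<in> V \<and> lev z \<le> lev w \<and> (par ^^ (lev w - lev z)) w = z"
  using assms
proof (induction rule: rtrancl_induct)
  case (step v w)
  then have w: "w \<in> V" "0 < lev w" "v = par w" by (auto simp: R_iff)
  then have lv: "lev v = lev w - 1" using par_V by blast
  have "lev w - lev z = Suc (lev v - lev z)" using step lv w(2) by auto
  then show ?case using step w lv by (simp add: funpow_Suc_right del: funpow.simps)
qed simp

lemma with_descendants_singleton:
  "with_descendants R {x} = insert x (\<Union>z\<in>R `` {x}. with_descendants R {z})"
  by (auto simp: with_descendants_def elim: converse_rtranclE intro: converse_rtrancl_into_rtrancl)

lemma mem_descendants: "w \<in> with_descendants R {z} \<longleftrightarrow> (z, w) \<in> R\<^sup>*"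
  by (simp add: with_descendants_def)

lemma R_unique: "(v, w) \<in> R \<Longrightarrow> (v', w) \<in> R \<Longrightarrow> v = v'"
  by (simp add: R_iff)

lemma parent_in_descendants:
  assumes "(z, w) \<in> R\<^sup>*" "w \<noteq> z" "(v, w) \<in> R" shows "(z, v) \<in> R\<^sup>*"
  using assms(1)
proof (cases rule: rtranclE)
  case (step v')
  then show ?thesis using R_unique[OF assms(3) step(2)] by simp
qed (use assms in simp)

lemma no_parent_of_top:
  assumes "(z, v) \<in> R\<^sup>*" "z \<in> V" shows "(v, z) \<notin> R"
proof
  assume "(v, z) \<in> R"
  then have "lev v = lev z - 1" "0 < lev z" using par_V by (auto simp: R_iff)
  then show False using descendant_ancestor[OF assms] by simp
qed

text \<open>
  The top of a subtree is its only vertex without a parent in the subtree.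
\<close>

lemma iso_top:
  assumes f: "iso_between R (with_descendants R {z}) (with_descendants R {z'}) f"
    and "z \<in> V" "z' \<in> V"
  shows "f z = z'"
proof (rule ccontr)
  assume ne: "f z \<noteq> z'"
  have bij: "bij_betw f (with_descendants R {z}) (with_descendants R {z'})"
    using f by (simp add: iso_between_def)
  have "f z \<in> with_descendants R {z'}" using bij_betw_apply[OF bij] by (simp add: mem_descendants)
  then have "(z', f z) \<in> R\<^sup>*" by (simp add: mem_descendants)
  then obtain v where v: "(z', v) \<in> R\<^sup>*" "(v, f z) \<in> R" using ne by (metis rtranclE)
  then have "v \<in> f ` with_descendants R {z}"
    using bij_betw_imp_surj_on[OF bij] by (simp add: mem_descendants)
  then obtain v' where v': "v = f v'" "(z, v') \<in> R\<^sup>*" by (auto simp: mem_descendants)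
  then have "(v', z) \<in> R" using f v by (auto simp: iso_between_def mem_descendants)
  then show False using no_parent_of_top[OF v'(2) \<open>z \<in> V\<close>] by blast
qed

text \<open>
  Send \<open>x\<close> to \<open>y\<close> and glue isomorphisms of the subtrees of the offspring, which are pairwise
  disjoint. An edge never joins two of these subtrees, and the edges out of \<open>x\<close> end in the tops of
  the subtrees, which the isomorphisms respect by \<open>iso_top\<close>.
\<close>

lemma iso_between_children:
  assumes x: "x \<in> V" and y: "y \<in> V"
    and h: "bij_betw h (R `` {x}) (R `` {y})"
    and iso: "\<And>z. (x, z) \<in> R \<Longrightarrow>
      \<exists>f. iso_between R (with_descendants R {z}) (with_descendants R {h z}) f"
  shows "\<exists>f. iso_between R (with_descendants R {x}) (with_descendants R {y}) f"
proof -
  let ?D = "\<lambda>z. with_descendants R {z}"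
  have "\<forall>z\<in>R `` {x}. \<exists>f. iso_between R (?D z) (?D (h z)) f" using iso by blast
  then obtain f where "\<forall>z\<in>R `` {x}. iso_between R (?D z) (?D (h z)) (f z)"
    by (rule bchoice[THEN exE])
  then have f: "iso_between R (?D z) (?D (h z)) (f z)" if "(x, z) \<in> R" for z using that by simp
  have child: "z \<in> V \<and> lev z = Suc (lev x')" if "(x', z) \<in> R" for x' z
    using that par_V[of z] by (auto simp: R_iff)
  have hz: "(y, h z) \<in> R" if "(x, z) \<in> R" for z using bij_betw_apply[OF h] that by simp
  have fD: "f z w \<in> ?D (h z)" if "(x, z) \<in> R" "w \<in> ?D z" for z w
    using f[OF that(1)] bij_betw_apply that(2) by (auto simp: iso_between_def)
  have siblings: "z = z'" if "(x', z) \<in> R" "(x', z') \<in> R" "w \<in> ?D z" "w \<in> ?D z'" for x' z z' w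
  proof -
    have up: "(par ^^ (lev w - Suc (lev x'))) w = v" if "(x', v) \<in> R" "w \<in> ?D v" for v
      using descendant_ancestor[of v w] child[OF that(1)] that(2) by (simp add: mem_descendants)
    show ?thesis using up[OF that(1,3)] up[OF that(2,4)] by (rule trans[OF sym])
  qed
  have not_top: "w \<noteq> x'" if "(x', z) \<in> R" "w \<in> ?D z" for x' z w
  proof -
    have "lev z \<le> lev w" using descendant_ancestor[of z w] child[OF that(1)] that(2)
      by (simp add: mem_descendants)
    then show ?thesis using child[OF that(1)] by auto
  qed
  define F where "F = (\<lambda>w. if w = x then y else f (THE z. (x, z) \<in> R \<and> w \<in> ?D z) w)"
  have Fx: "F x = y" by (simp add: F_def)
  have F: "F w = f z w" if "(x, z) \<in> R" "w \<in> ?D z" for z w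
  proof -
    have "(THE z. (x, z) \<in> R \<and> w \<in> ?D z) = z"
    proof (rule the_equality)
      show "z' = z" if z': "(x, z') \<in> R \<and> w \<in> ?D z'" for z'
        using siblings[of x z' z w] z' \<open>(x, z) \<in> R\<close> \<open>w \<in> ?D z\<close> by blast
    qed (use that in blast)
    then show ?thesis using not_top[OF that] by (simp add: F_def)
  qed
  have FD: "F w \<in> ?D (h z)" if "(x, z) \<in> R" "w \<in> ?D z" for z w using F[OF that] fD[OF that] by simp
  have dec: "w = x \<or> (\<exists>z. (x, z) \<in> R \<and> w \<in> ?D z)" if "w \<in> ?D x" for w
    using that unfolding with_descendants_singleton[of x] by blast
  have h_inj: "z = z'" if "(x, z) \<in> R" "(x, z') \<in> R" "h z = h z'" for z z'
    using inj_onD[OF bij_betw_imp_inj_on[OF h] that(3)] that by simp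
  have F_block: "w \<in> ?D z" if "w \<in> ?D x" "(x, z) \<in> R" "F w \<in> ?D (h z)" for w z
  proof (cases "w = x")
    case True
    then show ?thesis using not_top[OF hz[OF that(2)] that(3)] Fx by simp
  next
    case False
    then obtain z' where z': "(x, z') \<in> R" "w \<in> ?D z'" using dec \<open>w \<in> ?D x\<close> by blast
    have "h z' = h z" using siblings[OF hz[OF z'(1)] hz[OF that(2)] FD[OF z'] that(3)] .
    then show ?thesis using h_inj z' that(2) by blast
  qed
  have F_y: "w = x" if "w \<in> ?D x" "F w = y" for w
  proof (rule ccontr)
    assume "w \<noteq> x"
    then obtain z where z: "(x, z) \<in> R" "w \<in> ?D z" using dec \<open>w \<in> ?D x\<close> by blast
    then show False using not_top[OF hz[OF z(1)] FD[OF z]] that(2) by simp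
  qed
  have F_inj: "inj_on F (?D x)"
  proof (rule inj_onI)
    fix w w' assume w: "w \<in> ?D x" "w' \<in> ?D x" "F w = F w'"
    show "w = w'"
    proof (cases "w' = x")
      case True
      then show ?thesis using F_y w Fx by simp
    next
      case False
      then obtain z where z: "(x, z) \<in> R" "w' \<in> ?D z" using dec w(2) by blast
      have wz: "w \<in> ?D z" using F_block[OF w(1) z(1)] FD[OF z] w(3) by simp
      have "inj_on (f z) (?D z)" using f[OF z(1)] by (auto simp: iso_between_def bij_betw_def)
      then show ?thesis using w(3) F[OF z] F[OF z(1) wz] z(2) wz by (auto dest: inj_onD)
    qed
  qed
  have sub: "?D z \<subseteq> ?D x" if "(x, z) \<in> R" for z x
    using that unfolding with_descendants_singleton[of x] by blast
  have F_im: "F ` ?D x = ?D y"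
  proof (intro equalityI subsetI)
    fix v assume "v \<in> F ` ?D x"
    then obtain w where w: "v = F w" "w \<in> ?D x" by (rule imageE)
    show "v \<in> ?D y"
    proof (cases "w = x")
      case True
      then show ?thesis using w Fx by (simp add: mem_descendants)
    next
      case False
      then obtain z where z: "(x, z) \<in> R" "w \<in> ?D z" using dec w(2) by blast
      then show ?thesis using FD[OF z] sub[OF hz[OF z(1)]] w(1) by blast
    qed
  next
    fix v assume v: "v \<in> ?D y"
    show "v \<in> F ` ?D x"
    proof (cases "v = y")
      case True
      then show ?thesis using Fx by (intro image_eqI[of _ _ x]) (simp_all add: mem_descendants)
    next
      case False
      then obtain z' where z': "(y, z') \<in> R" "v \<in> ?D z'"
        using v unfolding with_descendants_singleton[of y] by blast
      then have "z' \<in> h ` (R `` {x})" using bij_betw_imp_surj_on[OF h] by simp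
      then obtain z where z: "z' = h z" "(x, z) \<in> R" by auto
      have "v \<in> f z ` ?D z" using f[OF z(2)] z' z(1) by (auto simp: iso_between_def bij_betw_def)
      then obtain w where w: "v = f z w" "w \<in> ?D z" by (rule imageE)
      then show ?thesis using F[OF z(2) w(2)] sub[OF z(2)] by (intro image_eqI[of _ _ w]) auto
    qed
  qed
  have "(w, w') \<in> R \<longleftrightarrow> (F w, F w') \<in> R" if w: "w \<in> ?D x" "w' \<in> ?D x" for w w'
  proof (cases "w' = x")
    case True
    have "F w \<in> ?D y" using F_im w(1) by blast
    then show ?thesis
      using True Fx no_parent_of_top[of x w] no_parent_of_top[of y "F w"] w x y
      by (simp add: mem_descendants)
  next
    case False
    then obtain z where z: "(x, z) \<in> R" "w' \<in> ?D z" using dec w(2) by blast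
    have zV: "z \<in> V" "h z \<in> V" using child z(1) hz[OF z(1)] by blast+
    have "z \<in> ?D z" by (simp add: mem_descendants)
    have Fz: "F z = h z"
      using F[OF z(1) \<open>z \<in> ?D z\<close>] iso_top[OF f[OF z(1)] zV] by simp
    show ?thesis
    proof (cases "w' = z")
      case True
      have "(w, z) \<in> R \<longleftrightarrow> w = x" using z(1) R_unique by blast
      moreover have "(F w, h z) \<in> R \<longleftrightarrow> F w = y" using hz[OF z(1)] R_unique by blast
      ultimately show ?thesis using True Fz F_y[OF w(1)] Fx by auto
    next
      case False
      have "F w' \<noteq> h z" using False inj_onD[OF F_inj, of w' z] Fz sub[OF z(1)] \<open>z \<in> ?D z\<close> w(2) by auto
      have 1: "w \<in> ?D z" if "(w, w') \<in> R"
        using parent_in_descendants[of z w' w] z(2) False that by (simp add: mem_descendants)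
      have 2: "w \<in> ?D z" if "(F w, F w') \<in> R"
        using parent_in_descendants[of "h z" "F w'" "F w"] FD[OF z] \<open>F w' \<noteq> h z\<close> that
          F_block[OF w(1) z(1)] by (simp add: mem_descendants)
      have 3: "(w, w') \<in> R \<longleftrightarrow> (F w, F w') \<in> R" if wz: "w \<in> ?D z"
        using f[OF z(1)] F[OF z] F[OF z(1) wz] z(2) wz by (auto simp: iso_between_def)
      from 1 2 3 show ?thesis by blast
    qed
  qed
  then have "iso_between R (?D x) (?D y) F"
    using F_inj F_im by (auto simp: iso_between_def bij_betw_def)
  then show ?thesis by blast
qed

end

lemma iso_between_refl: "iso_between R D D id"
  by (simp add: iso_between_def)

lemma iso_between_inverse:
  assumes "iso_between R D D' f" shows "iso_between R D' D (inv_into D f)"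
proof -
  have f: "bij_betw f D D'" using assms by (simp add: iso_between_def)
  then have g: "bij_betw (inv_into D f) D' D" by (rule bij_betw_inv_into)
  have "(y, y') \<in> R \<longleftrightarrow> (inv_into D f y, inv_into D f y') \<in> R" if "y \<in> D'" "y' \<in> D'" for y y'
    using assms that bij_betw_apply[OF g] bij_betw_inv_into_right[OF f]
    by (simp add: iso_between_def)
  with g show ?thesis by (simp add: iso_between_def)
qed

lemma iso_between_trans:
  assumes "iso_between R D D' f" "iso_between R D' D'' g" shows "iso_between R D D'' (g \<circ> f)"
  using assms bij_betw_trans[of f D D' g D''] bij_betw_apply[of f D D']
  by (auto simp: iso_between_def)

lemma vertex_equiv_equiv: "equiv (quot_verts N c S) (vertex_equiv N c S)"
proof (rule equivI)
  show "vertex_equiv N c S \<subseteq> quot_verts N c S \<times> quot_verts N c S" by (auto simp: vertex_equiv_def)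
  show "refl_on (quot_verts N c S) (vertex_equiv N c S)"
    by (rule refl_onI) (auto simp: vertex_equiv_def intro: iso_between_refl)
  show "sym (vertex_equiv N c S)"
    by (rule symI) (auto simp: vertex_equiv_def intro: iso_between_inverse)
  show "trans (vertex_equiv N c S)"
    by (rule transI) (auto simp: vertex_equiv_def intro: iso_between_trans)
qed

lemma component_equiv_equiv:
  "equiv (horiz_components N c S K \<kappa>) (component_equiv N c S K \<kappa>)"
proof (rule equivI)
  show "component_equiv N c S K \<kappa> \<subseteq> horiz_components N c S K \<kappa> \<times> horiz_components N c S K \<kappa>"
    by (auto simp: component_equiv_def)
  show "refl_on (horiz_components N c S K \<kappa>) (component_equiv N c S K \<kappa>)"
    by (rule refl_onI) (auto simp: component_equiv_def intro: iso_between_refl)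
  show "sym (component_equiv N c S K \<kappa>)"
    by (rule symI) (auto simp: component_equiv_def intro: iso_between_inverse)
  show "trans (component_equiv N c S K \<kappa>)"
    by (rule transI) (unfold component_equiv_def, blast intro: iso_between_trans)
qed

text \<open>
  With an index function for the enumerated classes, the entries of the incidence matrices count
  fibres of functions, to which \<open>bij_betw_matching_fibres\<close> applies.
\<close>

lemma exists_class_index:
  assumes r: "equiv V r" and f: "bij_betw f {1..k} (V // r)"
  shows "\<exists>ix. (\<forall>x\<in>V. ix x \<in> {1..k::nat} \<and> (\<forall>j\<in>{1..k}. x \<in> f j \<longleftrightarrow> ix x = j)) \<and>
    (\<forall>j\<in>{1..k}. f j \<subseteq> V \<and> (\<exists>x\<in>V. ix x = j)) \<and> (\<forall>x y. (x, y) \<in> r \<longrightarrow> ix x = ix y)"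
proof -
  define ix where "ix = (\<lambda>x. inv_into {1..k} f (r `` {x}))"
  have cls: "r `` {x} \<in> V // r" if "x \<in> V" for x using that by (rule quotientI)
  have ix: "ix x \<in> {1..k} \<and> f (ix x) = r `` {x}" if "x \<in> V" for x
    using bij_betw_apply[OF bij_betw_inv_into[OF f] cls[OF that]]
      bij_betw_inv_into_right[OF f cls[OF that]] by (simp add: ix_def)
  have fq: "f j \<in> V // r" if "j \<in> {1..k}" for j using bij_betw_apply[OF f that] .
  have fV: "f j \<subseteq> V" if "j \<in> {1..k}" for j
    using fq[OF that] Union_quotient[OF r] by blast
  have iff: "x \<in> f j \<longleftrightarrow> ix x = j" if "x \<in> V" "j \<in> {1..k}" for x j
  proof
    assume "x \<in> f j"
    then have "f j = r `` {x}"
      using fq[OF that(2)] cls[OF that(1)] quotient_disj[OF r] equiv_class_self[OF r that(1)] by blast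
    then show "ix x = j"
      using ix[OF that(1)] inj_onD[OF bij_betw_imp_inj_on[OF f], of "ix x" j] that(2) by simp
  next
    assume "ix x = j"
    then show "x \<in> f j" using ix[OF that(1)] equiv_class_self[OF r that(1)] by auto
  qed
  have "\<exists>x\<in>V. ix x = j" if "j \<in> {1..k}" for j
    using in_quotient_imp_non_empty[OF r fq[OF that]] fV[OF that] iff that by blast
  moreover have "ix x = ix y" if "(x, y) \<in> r" for x y
    using equiv_class_eq[OF r that] by (simp add: ix_def)
  ultimately show ?thesis using ix iff fV by (intro exI[of _ ix]) blast
qed


section \<open>The quotient of the augmented tree as a layered graph\<close>

locale self_similar =
  fixes N :: nat and c :: "nat \<Rightarrow> real" and S :: "nat \<Rightarrow> real ^ 'd \<Rightarrow> real ^ 'd"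
    and K :: "(real ^ 'd) set" and \<kappa> :: real
  assumes ifs: "self_similar_ifs N c S K" and \<kappa>: "0 < \<kappa>"
begin

abbreviation r :: real where "r \<equiv> min_ratio N c"
abbreviation W :: "nat \<Rightarrow> nat list set" where "W \<equiv> word_level N c"
abbreviation sm :: "(nat list \<times> nat list) set" where "sm \<equiv> same_map N c S"
abbreviation QL :: "nat \<Rightarrow> nat list set set" where "QL \<equiv> quot_level N c S"

lemma ratio_bounds: "i \<in> {1..N} \<Longrightarrow> 0 < c i \<and> c i < 1 \<and> r \<le> c i"
  using ifs unfolding self_similar_ifs_def min_ratio_def by (auto intro: Min_le)

lemma r_bounds: "0 < r \<and> r < 1"
proof -
  have "r \<in> c ` {1..N}"
    using ifs unfolding self_similar_ifs_def min_ratio_def by (intro Min_in) auto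
  then show ?thesis using ratio_bounds by auto
qed

lemma word_ratio_simps [simp]: "word_ratio c [] = 1" "word_ratio c (i # w) = c i * word_ratio c w"
  by (simp_all add: word_ratio_def)

lemma word_ratio_append: "word_ratio c (v @ w) = word_ratio c v * word_ratio c w"
  by (simp add: word_ratio_def)

lemma level_word: "w \<in> W k \<Longrightarrow> set w \<subseteq> {1..N}"
  by (auto simp: word_level_def split: if_splits)

text \<open>
  Appending a letter multiplies the ratio by at least \<open>r\<close>. So if the ratio exceeds \<open>r ^ i\<close>
  before the last letter, then it exceeds \<open>r ^ Suc i\<close> after it, which is too large for any
  level beyond \<open>i\<close>.
\<close>

lemma level_unique: assumes "w \<in> W i" "w \<in> W j" shows "i = j"
proof -
  have False if w: "w \<in> W i" "w \<in> W j" and "i < j" for i j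
  proof (cases "i = 0")
    case True
    then show ?thesis using w \<open>i < j\<close> by (auto simp: word_level_def)
  next
    case False
    then have ne: "w \<noteq> []" and sub: "set w \<subseteq> {1..N}" and low: "r ^ i < word_ratio c (butlast w)"
      and up: "word_ratio c w \<le> r ^ j"
      using w \<open>i < j\<close> by (auto simp: word_level_def)
    have last: "last w \<in> {1..N}" using last_in_set[OF ne] sub by blast
    have "r ^ j \<le> r ^ Suc i" using r_bounds \<open>i < j\<close> by (intro power_decreasing) auto
    also have "\<dots> = r ^ i * r" by simp
    also have "\<dots> < word_ratio c (butlast w) * r" using low r_bounds by simp
    also have "\<dots> \<le> word_ratio c (butlast w) * c (last w)"
      using ratio_bounds[OF last] less_imp_le[OF le_less_trans[OF zero_le_power[of r i] low]] r_bounds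
      by (intro mult_left_mono) auto
    also have "\<dots> = word_ratio c w"
      using word_ratio_append[of "butlast w" "[last w]"] ne by simp
    finally show False using up by simp
  qed
  from this[OF assms] this[OF assms(2,1)] show ?thesis by (meson linorder_neqE_nat)
qed

lemma level_finite: "finite (W k)"
proof (cases "k = 0")
  case True
  then show ?thesis by (simp add: word_level_def)
next
  case False
  define M where "M = Max (c ` {1..N})"
  have N: "c ` {1..N} \<noteq> {}" using ifs by (auto simp: self_similar_ifs_def)
  then have "M \<in> c ` {1..N}" unfolding M_def by (intro Max_in) auto
  then have M: "0 < M" "M < 1" using ratio_bounds by auto
  have bound: "word_ratio c w \<le> M ^ length w" if "set w \<subseteq> {1..N}" for w
    using that
  proof (induction w)
    case (Cons i w)
    have "0 \<le> word_ratio c w"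
      using Cons.prems ratio_bounds unfolding word_ratio_def by (force intro!: prod_list_nonneg)
    moreover have "c i \<le> M" using Cons.prems unfolding M_def by (intro Max_ge) auto
    ultimately show ?case using Cons M by (auto intro: mult_mono)
  qed simp
  obtain q where q: "M ^ q < r ^ k" using real_arch_pow_inv[of "r ^ k" M] r_bounds M by auto
  have "length w \<le> Suc q" if "w \<in> W k" for w
  proof (rule ccontr)
    assume "\<not> ?thesis"
    then have l: "q \<le> length (butlast w)" by simp
    have "set (butlast w) \<subseteq> {1..N}" using level_word[OF that] by (auto dest: in_set_butlastD)
    then have "r ^ k < M ^ length (butlast w)"
      using bound[of "butlast w"] that False by (simp add: word_level_def)
    also have "\<dots> \<le> M ^ q" using l M by (intro power_decreasing) auto
    finally show False using q by simp
  qed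
  then have "W k \<subseteq> {w. set w \<subseteq> {1..N} \<and> length w \<le> Suc q}" using level_word by blast
  then show ?thesis using finite_lists_length_le[of "{1..N}" "Suc q"] finite_subset by blast
qed

text \<open>
  The shortest prefix whose ratio has dropped to \<open>r ^ k\<close>.
\<close>

lemma exists_prefix:
  assumes y: "y \<in> W (Suc k)" shows "\<exists>x\<in>W k. prefix x y"
proof (cases "k = 0")
  case True
  then show ?thesis by (simp add: word_level_def)
next
  case False
  have "word_ratio c y \<le> r ^ Suc k" using y by (simp add: word_level_def)
  also have "\<dots> \<le> r ^ k" using r_bounds by (intro power_decreasing) auto
  finally have "word_ratio c (take (length y) y) \<le> r ^ k" by simp
  define l where "l = (LEAST l. word_ratio c (take l y) \<le> r ^ k)"
  have l: "word_ratio c (take l y) \<le> r ^ k" and l_le: "l \<le> length y"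
    unfolding l_def
    by (rule LeastI[of "\<lambda>l. word_ratio c (take l y) \<le> r ^ k"], fact)
       (rule Least_le[of "\<lambda>l. word_ratio c (take l y) \<le> r ^ k"], fact)
  have "r ^ k < 1" using r_bounds False by (simp add: power_less_one_iff)
  then have l0: "l \<noteq> 0" using l by (intro notI) simp
  have "\<not> word_ratio c (take (l - 1) y) \<le> r ^ k"
    using l0 unfolding l_def by (intro not_less_Least) auto
  then have "r ^ k < word_ratio c (butlast (take l y))" using butlast_take[OF l_le] by simp
  moreover have "take l y \<noteq> []" using l0 l_le by auto
  moreover have "set (take l y) \<subseteq> {1..N}" using level_word[OF y] set_take_subset[of l y] by auto
  ultimately have "take l y \<in> W k" using l False by (simp add: word_level_def)
  then show ?thesis using take_is_prefix by blast
qed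

lemma word_map_simps [simp]: "word_map S [] = id" "word_map S (i # w) = S i \<circ> word_map S w"
  by (simp_all add: word_map_def)

lemma word_map_append: "word_map S (v @ w) = word_map S v \<circ> word_map S w"
  by (induction v) auto

lemma word_map_K: "set w \<subseteq> {1..N} \<Longrightarrow> word_map S w ` K \<subseteq> K"
proof (induction w)
  case (Cons i w)
  have "K = (\<Union>i\<in>{1..N}. S i ` K)" using ifs by (simp add: self_similar_ifs_def)
  moreover have "i \<in> {1..N}" using Cons.prems by simp
  ultimately have "S i ` K \<subseteq> K" by blast
  with Cons show ?case by (auto simp: image_subset_iff)
qed simp

lemma prefix_cell:
  assumes "prefix x y" "set y \<subseteq> {1..N}"
  shows "word_map S y ` K \<subseteq> word_map S x ` K"
proof -
  obtain z where "y = x @ z" using assms(1) by (auto simp: prefix_def)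
  then show ?thesis using word_map_K[of z] assms(2) by (auto simp: word_map_append)
qed

lemma sm_equiv: "equiv (aug_verts N c) sm"
proof (rule equivI)
  show "sm \<subseteq> aug_verts N c \<times> aug_verts N c" by (auto simp: same_map_def aug_verts_def)
  show "refl_on (aug_verts N c) sm" by (rule refl_onI) (auto simp: same_map_def aug_verts_def)
  show "sym sm" by (rule symI) (auto simp: same_map_def)
  show "trans sm"
    by (rule transI) (auto simp: same_map_def dest: level_unique)
qed

lemma class_level: "w \<in> W k \<Longrightarrow> sm `` {w} \<in> QL k \<and> w \<in> sm `` {w}"
  using quotientI[of w "W k" sm] by (auto simp: quot_level_def) (auto simp: same_map_def)

lemma QL_mem: assumes "p \<in> QL k" "x \<in> p" shows "x \<in> W k \<and> p = sm `` {x}"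
proof -
  obtain w where w: "w \<in> W k" "p = sm `` {w}" using assms(1) by (auto simp: quot_level_def quotient_def)
  then have wx: "(w, x) \<in> sm" using assms(2) by simp
  then have "x \<in> W k" using w(1) level_unique by (auto simp: same_map_def)
  then show ?thesis using w equiv_class_eq[OF sm_equiv wx] by simp
qed

lemma QL_nonempty: "p \<in> QL k \<Longrightarrow> \<exists>x. x \<in> p"
  using class_level by (auto simp: quot_level_def quotient_def)

lemma QL_unique: "p \<in> QL i \<Longrightarrow> p \<in> QL j \<Longrightarrow> i = j"
  using QL_nonempty QL_mem level_unique by metis

lemma QL_finite: "finite (QL k)"
proof -
  have "QL k = (\<lambda>x. sm `` {x}) ` W k" by (auto simp: quot_level_def quotient_def)
  then show ?thesis using level_finite by simp
qed

lemma QL_finite_class: "p \<in> QL k \<Longrightarrow> finite p"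
  using QL_mem finite_subset[OF subsetI level_finite[of k]] by metis

lemma QL_disjoint: "\<lbrakk>p \<in> QL k; q \<in> QL k; x \<in> p; x \<in> q\<rbrakk> \<Longrightarrow> p = q"
  using QL_mem by metis

lemma QL_same: assumes "p \<in> QL k" "x \<in> p" "y \<in> p" shows "word_map S x = word_map S y"
  using QL_mem[OF assms(1,2)] assms(3) by (auto simp: same_map_def)

lemma quot_verts_QL: "quot_verts N c S = (\<Union>k. QL k)"
  by (auto simp: quot_verts_def quot_level_def aug_verts_def quotient_def)

lemma quot_parent_iff:
  "(p, q) \<in> quot_parent N c S \<longleftrightarrow>
    (\<exists>k. p \<in> QL k \<and> q \<in> QL (Suc k) \<and> (\<exists>x\<in>p. \<exists>y\<in>q. prefix x y))" (is "_ = ?r")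
proof
  assume "(p, q) \<in> quot_parent N c S"
  then obtain i j x y k where *: "p \<in> QL i" "q \<in> QL j" "x \<in> p" "y \<in> q" "prefix x y"
    "x \<in> W k" "y \<in> W (Suc k)"
    unfolding quot_parent_def induced_edges_def quot_verts_QL aug_parent_def mem_Collect_eq case_prod_conv UN_iff
    by blast
  have "i = k" "j = Suc k"
    using level_unique[of x i k] level_unique[of y j "Suc k"] QL_mem[OF *(1,3)] QL_mem[OF *(2,4)] *(6,7)
    by simp_all
  with * show ?r by blast
next
  assume ?r
  then obtain k x y where *: "p \<in> QL k" "q \<in> QL (Suc k)" "x \<in> p" "y \<in> q" "prefix x y" by blast
  have "x \<in> W k" "y \<in> W (Suc k)" "p \<noteq> q"
    using QL_mem[OF *(1,3)] QL_mem[OF *(2,4)] QL_unique[OF *(1), of "Suc k"] *(2) by auto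
  with * show "(p, q) \<in> quot_parent N c S"
    unfolding quot_parent_def induced_edges_def quot_verts_QL aug_parent_def mem_Collect_eq case_prod_conv UN_iff
    by blast
qed

lemma quot_horiz_iff:
  "(p, q) \<in> quot_horiz N c S K \<kappa> \<longleftrightarrow>
    (\<exists>k. p \<in> QL k \<and> q \<in> QL k \<and> p \<noteq> q \<and>
      (\<exists>x\<in>p. \<exists>y\<in>q. setdist (word_map S x ` K) (word_map S y ` K) \<le> \<kappa> * r ^ k))" (is "_ = ?r")
proof
  assume "(p, q) \<in> quot_horiz N c S K \<kappa>"
  then obtain i j x y k where *: "p \<in> QL i" "q \<in> QL j" "x \<in> p" "y \<in> q" "p \<noteq> q"
    "setdist (word_map S x ` K) (word_map S y ` K) \<le> \<kappa> * r ^ k" "x \<in> W k" "y \<in> W k"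
    unfolding quot_horiz_def induced_edges_def quot_verts_QL aug_horiz_def mem_Collect_eq case_prod_conv UN_iff
    by blast
  have "i = k" "j = k"
    using level_unique[of x i k] level_unique[of y j k] QL_mem[OF *(1,3)] QL_mem[OF *(2,4)] *(7,8)
    by simp_all
  with * show ?r by blast
next
  assume ?r
  then obtain k x y where *: "p \<in> QL k" "q \<in> QL k" "p \<noteq> q" "x \<in> p" "y \<in> q"
    "setdist (word_map S x ` K) (word_map S y ` K) \<le> \<kappa> * r ^ k" by blast
  have "x \<in> W k" "y \<in> W k" "x \<noteq> y"
    using QL_mem[OF *(1,4)] QL_mem[OF *(2,5)] *(3) by auto
  with * show "(p, q) \<in> quot_horiz N c S K \<kappa>"
    unfolding quot_horiz_def induced_edges_def quot_verts_QL aug_horiz_def mem_Collect_eq case_prod_conv UN_iff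
    by blast
qed

lemma setdist_cells_mono:
  assumes "prefix x y" "prefix x' y'" "set y \<subseteq> {1..N}" "set y' \<subseteq> {1..N}"
  shows "setdist (word_map S x ` K) (word_map S x' ` K) \<le> setdist (word_map S y ` K) (word_map S y' ` K)"
proof -
  have ne: "word_map S w ` K \<noteq> {}" for w using ifs by (simp add: self_similar_ifs_def)
  show ?thesis
    using setdist_subset_left[OF ne prefix_cell[OF assms(1,3)]]
      setdist_subset_right[OF ne prefix_cell[OF assms(2,4)]] by (rule order_trans)
qed

text \<open>
  The cell of a word contains the cells of its extensions, so passing to parents does not
  increase the distance of cells, whereas the threshold \<open>\<kappa> * r ^ k\<close> only grows. Two parents of
  the same vertex have cells with a common subset, at distance zero.
\<close>

lemma parents_near:
  assumes p: "(p, q) \<in> quot_parent N c S" "(p', q') \<in> quot_parent N c S"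
    and q: "q = q' \<or> (q, q') \<in> quot_horiz N c S K \<kappa>"
  shows "(p, p') \<in> (quot_horiz N c S K \<kappa>)\<^sup>*"
proof -
  obtain k x y where 1: "p \<in> QL k" "q \<in> QL (Suc k)" "x \<in> p" "y \<in> q" "prefix x y"
    using p(1) unfolding quot_parent_iff by blast
  obtain k' x' y' where 2: "p' \<in> QL k'" "q' \<in> QL (Suc k')" "x' \<in> p'" "y' \<in> q'" "prefix x' y'"
    using p(2) unfolding quot_parent_iff by blast
  have le: "\<kappa> * r ^ Suc k \<le> \<kappa> * r ^ k"
    using \<kappa> r_bounds by (intro mult_left_mono power_decreasing) auto
  have *: "k' = k \<and> setdist (word_map S y ` K) (word_map S y' ` K) \<le> \<kappa> * r ^ Suc k"
    using q
  proof
    assume "q = q'"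
    then have "word_map S y = word_map S y'" "k' = k"
      using 1 2 QL_same[of q "Suc k" y y'] QL_unique by auto
    then show ?thesis using \<kappa> r_bounds by (simp add: setdist_refl)
  next
    assume "(q, q') \<in> quot_horiz N c S K \<kappa>"
    then obtain j z z' where z: "q \<in> QL j" "q' \<in> QL j" "z \<in> q" "z' \<in> q'"
      "setdist (word_map S z ` K) (word_map S z' ` K) \<le> \<kappa> * r ^ j"
      unfolding quot_horiz_iff by blast
    have "j = Suc k" "k' = k" using QL_unique z 1 2 by blast+
    then show ?thesis
      using z QL_same[OF z(1) 1(4) z(3)] QL_same[OF z(2) 2(4) z(4)] by simp
  qed
  have "setdist (word_map S x ` K) (word_map S x' ` K) \<le> \<kappa> * r ^ k"
    using setdist_cells_mono[OF 1(5) 2(5)] level_word QL_mem[OF 1(2,4)] QL_mem[OF 2(2,4)] * le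
    by (meson order_trans)
  then have "p = p' \<or> (p, p') \<in> quot_horiz N c S K \<kappa>"
    using 1 2 * unfolding quot_horiz_iff by blast
  then show ?thesis by auto
qed

text \<open>
  A vertex has a unique parent in the reduced tree because different parents are disjoint sets of
  words, hence have different smallest words.
\<close>

sublocale G: layered_graph QL "quot_parent N c S" "quot_horiz N c S K \<kappa>" "red_parent N c S"
  "quot_root N c S"
proof
  show "QL 0 = {quot_root N c S}"
    by (auto simp: quot_level_def quot_root_def word_level_def quotient_def)
  show "sym (quot_horiz N c S K \<kappa>)"
  proof (rule symI)
    fix p q assume "(p, q) \<in> quot_horiz N c S K \<kappa>"
    then obtain k x y where *: "p \<in> QL k" "q \<in> QL k" "p \<noteq> q" "x \<in> p" "y \<in> q"
      "setdist (word_map S x ` K) (word_map S y ` K) \<le> \<kappa> * r ^ k"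
      unfolding quot_horiz_iff by blast
    have "setdist (word_map S y ` K) (word_map S x ` K) \<le> \<kappa> * r ^ k"
      using *(6) by (simp only: setdist_sym)
    with *(1-5) show "(q, p) \<in> quot_horiz N c S K \<kappa>"
      unfolding quot_horiz_iff by blast
  qed
  show "red_parent N c S \<subseteq> quot_parent N c S" by (auto simp: red_parent_def)
  show "\<exists>!p. (p, q) \<in> red_parent N c S" if q: "q \<in> QL (Suc k)" for q k
  proof -
    define Ps where "Ps = {p. (p, q) \<in> quot_parent N c S}"
    have PsL: "p \<in> QL k" if p: "p \<in> Ps" for p
    proof -
      obtain j where "p \<in> QL j" "q \<in> QL (Suc j)" using p unfolding Ps_def quot_parent_iff by blast
      then show ?thesis using QL_unique[OF q, of "Suc j"] by simp
    qed
    have fin: "finite Ps" using finite_subset[OF subsetI QL_finite] PsL by metis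
    obtain y where y: "y \<in> q" using QL_nonempty q by blast
    obtain x where "x \<in> W k" "prefix x y" using exists_prefix QL_mem[OF q y] by blast
    then have "(sm `` {x}, q) \<in> quot_parent N c S"
      unfolding quot_parent_iff using class_level[of x k] q y by blast
    then have ne: "Ps \<noteq> {}" by (auto simp: Ps_def)
    have mem: "Min p \<in> p" if "p \<in> Ps" for p
      using QL_finite_class QL_nonempty PsL[OF that] by (intro Min_in) auto
    have "Min (Min ` Ps) \<in> Min ` Ps" using fin ne by (intro Min_in) auto
    then obtain p where p: "p \<in> Ps" "Min p = Min (Min ` Ps)" by (metis imageE)
    have "Min p \<le> Min p'" if "p' \<in> Ps" for p' using p(2) fin that by simp
    then have "(p, q) \<in> red_parent N c S" using p(1) by (auto simp: red_parent_def Ps_def)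
    moreover have "p' = p" if "(p', q) \<in> red_parent N c S" for p'
    proof -
      have p': "p' \<in> Ps" using that by (simp add: red_parent_def Ps_def)
      have "Min p' = Min p"
        using that \<open>(p, q) \<in> red_parent N c S\<close> by (auto simp: red_parent_def intro: antisym)
      then show ?thesis using QL_disjoint[OF PsL[OF p'] PsL[OF p(1)]] mem[OF p'] mem[OF p(1)] by simp
    qed
    ultimately show ?thesis by blast
  qed
qed (use QL_finite QL_unique parents_near in \<open>auto simp: quot_parent_iff quot_horiz_iff\<close>)

lemma V_eq: "G.V = quot_verts N c S"
  by (simp add: G.V_def quot_verts_QL)

lemma edge_connected_hcomp: "edge_connected (quot_horiz N c S K \<kappa>) (G.hcomp x)"
  unfolding edge_connected_def
proof (intro ballI)
  fix y z assume yz: "y \<in> G.hcomp x" "z \<in> G.hcomp x"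
  then have *: "(x, y) \<in> (quot_horiz N c S K \<kappa>)\<^sup>*" "(x, z) \<in> (quot_horiz N c S K \<kappa>)\<^sup>*"
    by (simp_all add: G.mem_hcomp)
  have "(y, z) \<in> (quot_horiz N c S K \<kappa>)\<^sup>*" using G.hconn_sym[OF *(1)] *(2) by (rule rtrancl_trans)
  then have "(y, z) \<in> (quot_horiz N c S K \<kappa> \<inter> G.hcomp y \<times> G.hcomp y)\<^sup>*"
    by (rule G.edges_connected_hcomp)
  moreover have "G.hcomp y = G.hcomp x" using iffD2[OF G.hcomp_eq_iff *(1)] by (rule sym)
  ultimately show "(y, z) \<in> (quot_horiz N c S K \<kappa> \<inter> G.hcomp x \<times> G.hcomp x)\<^sup>*" by (simp only:)
qed

lemma edge_connected_subset_hcomp: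
  assumes "edge_connected (quot_horiz N c S K \<kappa>) T" "x \<in> T" shows "T \<subseteq> G.hcomp x"
proof
  fix y assume "y \<in> T"
  then have "(x, y) \<in> (quot_horiz N c S K \<kappa> \<inter> T \<times> T)\<^sup>*" using assms by (simp add: edge_connected_def)
  then show "y \<in> G.hcomp x"
    unfolding G.mem_hcomp by (rule subsetD[OF rtrancl_mono, rotated]) (rule Int_lower1)
qed

lemma horiz_components_eq: "horiz_components N c S K \<kappa> = G.hcomp ` G.V"
proof (intro equalityI subsetI)
  fix T assume "T \<in> horiz_components N c S K \<kappa>"
  then have *: "T \<noteq> {} \<and> (\<exists>k. T \<subseteq> QL k \<and> edge_connected (quot_horiz N c S K \<kappa>) T \<and>
      (\<forall>T'. T \<subseteq> T' \<and> T' \<subseteq> QL k \<and> edge_connected (quot_horiz N c S K \<kappa>) T' \<longrightarrow> T' = T))"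
    unfolding horiz_components_def by (rule CollectD)
  obtain k where k: "T \<subseteq> QL k \<and> edge_connected (quot_horiz N c S K \<kappa>) T \<and>
      (\<forall>T'. T \<subseteq> T' \<and> T' \<subseteq> QL k \<and> edge_connected (quot_horiz N c S K \<kappa>) T' \<longrightarrow> T' = T)"
    using conjunct2[OF *] by (rule exE)
  have T: "T \<noteq> {}" "T \<subseteq> QL k" "edge_connected (quot_horiz N c S K \<kappa>) T"
    using * k by simp_all
  have maximal: "T' = T" if "T \<subseteq> T'" "T' \<subseteq> QL k" "edge_connected (quot_horiz N c S K \<kappa>) T'" for T'
    using k that by simp
  obtain x where x: "x \<in> T" using T(1) by blast
  then have xk: "x \<in> QL k" using T(2) by blast
  have "G.hcomp x = T"
    by (rule maximal[OF edge_connected_subset_hcomp[OF T(3) x] G.hcomp_L[OF xk]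
          edge_connected_hcomp])
  then show "T \<in> G.hcomp ` G.V" using G.L_V[OF xk] by (rule image_eqI[OF sym])
next
  fix T assume "T \<in> G.hcomp ` G.V"
  then obtain x where x: "T = G.hcomp x" "x \<in> G.V" by (rule imageE)
  have mem: "x \<in> T" using x(1) by (simp add: G.mem_hcomp)
  have "T' = T" if "T \<subseteq> T'" "edge_connected (quot_horiz N c S K \<kappa>) T'" for T'
  proof (rule antisym)
    show "T' \<subseteq> T" unfolding x(1)
      by (rule edge_connected_subset_hcomp[OF that(2) subsetD[OF that(1) mem]])
  qed (fact that(1))
  moreover have "T \<subseteq> QL (G.lev x)" unfolding x(1) by (rule G.hcomp_L[OF G.L_lev[OF x(2)]])
  moreover have "edge_connected (quot_horiz N c S K \<kappa>) T"
    unfolding x(1) by (rule edge_connected_hcomp)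
  moreover have "T \<noteq> {}" using mem by blast
  ultimately show "T \<in> horiz_components N c S K \<kappa>"
    unfolding horiz_components_def by (intro CollectI conjI exI[of _ "G.lev x"] allI impI) simp_all
qed

text \<open>
  Hence the rows of the incidence matrix of the reduced tree are pairwise distinct.
\<close>

lemma vertex_equiv_of_children:
  assumes xy: "x \<in> G.V" "y \<in> G.V"
    and ix: "\<And>z w. \<lbrakk>z \<in> G.V; w \<in> G.V; ix z = ix w\<rbrakk> \<Longrightarrow> (z, w) \<in> vertex_equiv N c S"
    and counts: "\<And>k. card {z. (x, z) \<in> red_parent N c S \<and> ix z = k} =
      card {z. (y, z) \<in> red_parent N c S \<and> ix z = k}"
  shows "(x, y) \<in> vertex_equiv N c S"
proof -
  let ?R = "red_parent N c S"
  have "\<exists>h. bij_betw h (?R `` {x}) (?R `` {y}) \<and> (\<forall>z\<in>?R `` {x}. ix (h z) = ix z)"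
    using counts by (intro bij_betw_matching_fibres G.finite_R_image) simp
  then obtain h where h: "bij_betw h (?R `` {x}) (?R `` {y})" "\<And>z. (x, z) \<in> ?R \<Longrightarrow> ix (h z) = ix z"
    by auto
  have "\<exists>f. iso_between ?R (with_descendants ?R {z}) (with_descendants ?R {h z}) f"
    if z: "(x, z) \<in> ?R" for z
  proof -
    have "(y, h z) \<in> ?R" using bij_betw_apply[OF h(1)] z by simp
    then have "z \<in> G.V" "h z \<in> G.V" using z by (simp_all add: G.R_iff)
    then have "(z, h z) \<in> vertex_equiv N c S" using ix h(2)[OF z] by simp
    then show ?thesis by (simp add: vertex_equiv_def)
  qed
  then show ?thesis
    using G.iso_between_children[OF xy h(1)] xy by (simp add: vertex_equiv_def V_eq)
qed

end


section \<open>Near-isometry and boundary of the quotient space\<close>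

theorem theorem1p2:
  fixes N :: nat and c :: "nat \<Rightarrow> real" and S :: "nat \<Rightarrow> real ^ 'd \<Rightarrow> real ^ 'd"
    and K :: "(real ^ 'd) set" and \<kappa> :: real
    and m n :: nat
    and \<T> :: "nat \<Rightarrow> nat list set set set" and \<t> :: "nat \<Rightarrow> nat list set set"
    and A B u :: "nat \<Rightarrow> nat \<Rightarrow> nat"
  assumes ifs: "self_similar_ifs N c S K"
    and kappa: "\<kappa> > 0"
    and simple: "quot_simple N c S K \<kappa>"
    and comp_classes: "bij_betw \<T> {1..m} (component_classes N c S K \<kappa>)"
    and A: "quot_incidence_matrix N c S m \<T> A"
    and tree_simple: "red_simple N c S"
    and vert_classes: "bij_betw \<t> {1..n} (vertex_classes N c S)" "quot_root N c S \<in> \<t> 1"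
    and B: "red_incidence_matrix N c S n \<t> B"
    and u: "class_representation m n \<T> \<t> u"
    and rearr: "rearrangeable m n B u A"
  shows "(\<exists>\<sigma>. near_isometry (quot_verts N c S) (quot_edges N c S K \<kappa>)
                 (quot_verts N c S) (red_edges N c S) \<sigma>) \<and>
         (\<forall>\<delta> a. hyperbolic_graph (quot_verts N c S) (quot_edges N c S K \<kappa>) (quot_root N c S) \<delta> \<and>
                 a > 0 \<and> exp (3 * \<delta> * a) < sqrt 2 \<longrightarrow>
            lipschitz_equivalent
              (hyp_boundary (quot_verts N c S) (quot_edges N c S K \<kappa>) (quot_root N c S) a)
              (boundary_rho (quot_edges N c S K \<kappa>) (quot_root N c S) a)
              (hyp_boundary (quot_verts N c S) (red_edges N c S) (quot_root N c S) a)
              (boundary_rho (red_edges N c S) (quot_root N c S) a))"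
proof -
  interpret self_similar N c S K \<kappa> using ifs kappa by unfold_locales
  let ?P = "quot_parent N c S" and ?R = "red_parent N c S"
  from exists_class_index[OF component_equiv_equiv comp_classes[unfolded component_classes_def]]
  obtain ct where ct_index: "(\<forall>T\<in>G.hcomp ` G.V. ct T \<in> {1..m} \<and> (\<forall>l\<in>{1..m}. T \<in> \<T> l \<longleftrightarrow> ct T = l)) \<and>
      (\<forall>l\<in>{1..m}. \<T> l \<subseteq> G.hcomp ` G.V \<and> (\<exists>T\<in>G.hcomp ` G.V. ct T = l)) \<and>
      (\<forall>T T'. (T, T') \<in> component_equiv N c S K \<kappa> \<longrightarrow> ct T = ct T')"
    unfolding horiz_components_eq by (rule exE)
  have ct: "ct (G.hcomp x) \<in> {1..m}" "G.hcomp x \<in> \<T> (ct (G.hcomp x))" if "x \<in> G.V" for x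
    using conjunct1[OF ct_index] that by simp_all
  have ct_iff: "T \<in> \<T> l \<longleftrightarrow> T \<in> G.hcomp ` G.V \<and> ct T = l" if "l \<in> {1..m}" for T l
    using ct_index that by blast
  from exists_class_index[OF vertex_equiv_equiv vert_classes(1)[unfolded vertex_classes_def]]
  obtain ty where ty_index: "(\<forall>x\<in>G.V. ty x \<in> {1..n} \<and> (\<forall>j\<in>{1..n}. x \<in> \<t> j \<longleftrightarrow> ty x = j)) \<and>
      (\<forall>j\<in>{1..n}. \<t> j \<subseteq> G.V \<and> (\<exists>x\<in>G.V. ty x = j)) \<and>
      (\<forall>x y. (x, y) \<in> vertex_equiv N c S \<longrightarrow> ty x = ty y)"
    unfolding V_eq[symmetric] by (rule exE)
  have ty: "ty x \<in> {1..n}" "x \<in> \<t> (ty x)" if "x \<in> G.V" for x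
    using conjunct1[OF ty_index] that by simp_all
  have ty_iff: "x \<in> \<t> j \<longleftrightarrow> x \<in> G.V \<and> ty x = j" if "j \<in> {1..n}" for x j
    using ty_index that by blast
  have ty_surj: "\<exists>x\<in>G.V. ty x = j" if "j \<in> {1..n}" for j using ty_index that by simp
  have ty_equiv: "ty x = ty y" if "(x, y) \<in> vertex_equiv N c S" for x y using ty_index that by simp
  have equiv_ty: "(x, y) \<in> vertex_equiv N c S" if "x \<in> G.V" "y \<in> G.V" "ty x = ty y" for x y
  proof -
    have "x \<in> \<t> (ty x)" "y \<in> \<t> (ty x)" using ty(2)[OF that(1)] ty(2)[OF that(2)] that(3) by simp_all
    moreover have "\<t> (ty x) \<in> quot_verts N c S // vertex_equiv N c S"
      using bij_betw_apply[OF vert_classes(1) ty(1)[OF that(1)]] by (simp add: vertex_classes_def)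
    ultimately show ?thesis
      using in_quotient_imp_in_rel[OF vertex_equiv_equiv, of _ N c S x y] by simp
  qed
  have B': "B (ty x) k = card {y. (x, y) \<in> ?R \<and> ty y = k}" if "x \<in> G.V" "k \<in> {1..n}" for x k
  proof -
    have "B (ty x) k = card {y \<in> \<t> k. (x, y) \<in> ?R}"
      using B ty[OF that(1)] that(2) unfolding red_incidence_matrix_def by simp
    also have "{y \<in> \<t> k. (x, y) \<in> ?R} = {y. (x, y) \<in> ?R \<and> ty y = k}"
      using ty_iff[OF that(2)] by (auto simp: G.R_iff)
    finally show ?thesis .
  qed
  interpret rearrangeable_graph QL ?P "quot_horiz N c S K \<kappa>" ?R "quot_root N c S" m n A B u ty ct
  proof
    show "A (ct (G.hcomp x)) l = card {Z \<in> G.hcomp ` G.V. Z \<subseteq> ?P `` G.hcomp x \<and> ct Z = l}"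
      if "x \<in> G.V" "l \<in> {1..m}" for x l
    proof -
      have "A (ct (G.hcomp x)) l = card {Z \<in> \<T> l. Z \<subseteq> ?P `` G.hcomp x}"
        using A ct[OF that(1)] that(2) unfolding quot_incidence_matrix_def by simp
      also have "{Z \<in> \<T> l. Z \<subseteq> ?P `` G.hcomp x} = {Z \<in> G.hcomp ` G.V. Z \<subseteq> ?P `` G.hcomp x \<and> ct Z = l}"
        using ct_iff[OF that(2)] by blast
      finally show ?thesis .
    qed
    show "u (ct (G.hcomp x)) k = card {y \<in> G.hcomp x. ty y = k}" if "x \<in> G.V" "k \<in> {1..n}" for x k
    proof -
      have "u (ct (G.hcomp x)) k = card {y \<in> G.hcomp x. y \<in> \<t> k}"
        using u ct[OF that(1)] that(2) unfolding class_representation_def by simp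
      also have "{y \<in> G.hcomp x. y \<in> \<t> k} = {y \<in> G.hcomp x. ty y = k}"
        using ty_iff[OF that(2)] G.hconn_V[OF _ that(1)] unfolding G.mem_hcomp by blast
      finally show ?thesis .
    qed
    show "ty x = ty y" if "x \<in> G.V" "y \<in> G.V" "\<forall>k\<in>{1..n}. B (ty x) k = B (ty y) k" for x y
    proof (rule ty_equiv, rule vertex_equiv_of_children[OF that(1,2) equiv_ty])
      fix k
      show "card {z. (x, z) \<in> ?R \<and> ty z = k} = card {z. (y, z) \<in> ?R \<and> ty z = k}"
      proof (cases "k \<in> {1..n}")
        case True
        then show ?thesis using B'[OF that(1) True] B'[OF that(2) True] that(3) by simp
      next
        case False
        have "{z. (v, z) \<in> ?R \<and> ty z = k} = {}" for v using False ty(1) unfolding G.R_iff by blast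
        then show ?thesis by (simp only:)
      qed
    qed
    show "ct (G.hcomp x) \<in> {1..m}" if "x \<in> G.V" for x using ct(1)[OF that] .
  qed (fact ty(1) B' ty_surj rearr)+
  have edges: "quot_edges N c S K \<kappa> = ?P \<union> ?P\<inverse> \<union> quot_horiz N c S K \<kappa>"
    "red_edges N c S = ?R \<union> ?R\<inverse>"
    by (simp_all add: quot_edges_def red_edges_def)
  obtain \<sigma> where \<sigma>: "near_isometry (quot_verts N c S) (quot_edges N c S K \<kappa>)
      (quot_verts N c S) (red_edges N c S) \<sigma>" "\<sigma> (quot_root N c S) = quot_root N c S"
    using exists_near_isometry unfolding V_eq edges by blast
  have root: "quot_root N c S \<in> quot_verts N c S" using G.L_0 by (auto simp: quot_verts_QL)
  show ?thesis
    using \<sigma>(1) near_isometry_imp_lipschitz_equivalent_boundaries[OF \<sigma>(1) root] unfolding \<sigma>(2) by blast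
qed

end
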